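(* Let $\mathcal{Q}$ be a small quantaloid. For $\mathcal{Q}$-categories $\mathbb{A}$ and $\mathbb{B}$, the following are equivalent: (1) $\mathbb{A}\cong\mathbb{B}$ in $\mathsf{Dist}(\mathcal{Q})$; (2) $\mathbb{A}_{\mathsf{cc}}\simeq\mathbb{B}_{\mathsf{cc}}$ in $\mathsf{Cat}(\mathcal{Q})$; (3) $\mathcal{P}\mathbb{A}\simeq\mathcal{P}\mathbb{B}$ in $\mathsf{Cat}(\mathcal{Q})$; (4) $\mathcal{P}^{\dagger}\mathbb{A}\simeq\mathcal{P}^{\dagger}\mathbb{B}$ in $\mathsf{Cat}(\mathcal{Q})$.
   Context: A sup-lattice is a partially ordered set in which every subset has a supremum. A quantaloid $\mathcal{Q}$ is a category whose hom-sets are sup-lattices and whose composition preserves arbitrary suprema in each variable; it is small if its objects form a set. In any quantaloid, for $g:B\to C$ and $h:A\to C$, $[g,h]:A\to B$ denotes the largest $x$ with $g\circ x\leq h$; for $f:A\to B$ and $h:A\to C$, $\{f,h\}:B\to C$ denotes the largest $y$ with $y\circ f\leq h$; an arrow $f:A\to B$ is left adjoint to $g:B\to A$ if $1_A\leq g\circ f$ and $f\circ g\leq 1_B$. A $\mathcal{Q}$-category $\mathbb{A}$ is a set $\mathbb{A}_0$ of objects, each $a$ having a type $ta\in\mathcal{Q}$, with arrows $\mathbb{A}(a',a):ta\to ta'$ in $\mathcal{Q}$ such that $\mathbb{A}(a'',a')\circ\mathbb{A}(a',a)\leq\mathbb{A}(a'',a)$ and $1_{ta}\leq\mathbb{A}(a,a)$.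 A distributor $\Phi:\mathbb{A}\nrightarrow\mathbb{B}$ is a family of arrows $\Phi(b,a):ta\to tb$ with $\mathbb{B}(b',b)\circ\Phi(b,a)\leq\Phi(b',a)$ and $\Phi(b,a)\circ\mathbb{A}(a,a')\leq\Phi(b,a')$. A functor $F:\mathbb{A}\to\mathbb{B}$ is a map $\mathbb{A}_0\to\mathbb{B}_0$ with $t(Fa)=ta$ and $\mathbb{A}(a',a)\leq\mathbb{B}(Fa',Fa)$. $\mathcal{Q}$-categories and distributors form a quantaloid $\mathsf{Dist}(\mathcal{Q})$ with composition $(\Psi\otimes_{\mathbb{B}}\Phi)(c,a)=\bigvee_{b}\Psi(c,b)\circ\Phi(b,a)$, identities $\mathbb{A}:\mathbb{A}\nrightarrow\mathbb{A}$ (the hom-arrows), and elementwise order; $[-,-]$ and $\{-,-\}$ are also used in $\mathsf{Dist}(\mathcal{Q})$. For functors $F,G:\mathbb{A}\to\mathbb{B}$ put $F\leq G$ iff $1_{ta}\leq\mathbb{B}(Fa,Ga)$ for all $a$, and $F\cong G$ iff $F\leq G\leq F$; this makes $\mathcal{Q}$-categories and functors a locally ordered 2-category $\mathsf{Cat}(\mathcal{Q})$. $\mathbb{A}\simeq\mathbb{B}$ in $\mathsf{Cat}(\mathcal{Q})$ means there are functors $F:\mathbb{A}\to\mathbb{B}$, $G:\mathbb{B}\to\mathbb{A}$ with $G\circ F\cong 1_{\mathbb{A}}$ and $F\circ G\cong 1_{\mathbb{B}}$. For $C\in\mathcal{Q}$, $*_C$ is the one-object $\mathcal{Q}$-category of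 type $C$ with hom-arrow $1_C$. $\mathcal{P}\mathbb{A}$ is the $\mathcal{Q}$-category whose objects of type $C$ are the distributors $\phi:*_C\nrightarrow\mathbb{A}$, with $\mathcal{P}\mathbb{A}(\psi,\phi)$ the single element of $[\psi,\phi]$. $\mathcal{P}^{\dagger}\mathbb{A}$ is the $\mathcal{Q}$-category whose objects of type $C$ are the distributors $\phi:\mathbb{A}\nrightarrow *_C$, with $\mathcal{P}^{\dagger}\mathbb{A}(\psi,\phi)$ the single element of $\{\phi,\psi\}$. $\mathbb{A}_{\mathsf{cc}}$ (the Cauchy completion) is the full subcategory of $\mathcal{P}\mathbb{A}$ (same hom-arrows) whose objects are those $\phi:*_C\nrightarrow\mathbb{A}$ having a right adjoint in $\mathsf{Dist}(\mathcal{Q})$. *)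

theory Defs
  imports "HOL-Algebra.Complete_Lattice" "HOL-Library.FuncSet"
begin

section \<open>Quantaloids\<close>

locale sup_lattice = partial_order +
  assumes sup_exists: "S \<subseteq> carrier L \<Longrightarrow> \<exists>s. least L s (Upper L S)"

text \<open>The order \<open>Le\<close> is only meaningful between parallel arrows. The objects and arrows of a
  quantaloid form sets, so every quantaloid in this sense is small.\<close>

record ('o, 'm) quantaloid =
  Obj :: "'o set"
  Arr :: "'m set"
  Dom :: "'m \<Rightarrow> 'o"
  Cod :: "'m \<Rightarrow> 'o"
  Idn :: "'o \<Rightarrow> 'm" (\<open>\<one>\<index>_\<close> [1000] 1000)
  Comp :: "'m \<Rightarrow> 'm \<Rightarrow> 'm" (infixl \<open>\<cdot>\<index>\<close> 70)
  Le :: "'m \<Rightarrow> 'm \<Rightarrow> bool" (infix \<open>\<preceq>\<index>\<close> 50)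

definition Hom :: "('o, 'm) quantaloid \<Rightarrow> 'o \<Rightarrow> 'o \<Rightarrow> 'm gorder" where
  "Hom Q X Y = \<lparr>carrier = {f \<in> Arr Q. Dom Q f = X \<and> Cod Q f = Y}, eq = (=), le = Le Q\<rparr>"

text \<open>Composition is in applicative order: \<open>g \<cdot> f\<close> is \<open>g\<close> after \<open>f\<close>. The sets \<open>S\<close> in the last
  two axioms may be empty.\<close>

locale quantaloid =
  fixes Q :: "('o, 'm) quantaloid" (structure)
  assumes Dom_Obj: "f \<in> Arr Q \<Longrightarrow> Dom Q f \<in> Obj Q"
    and Cod_Obj: "f \<in> Arr Q \<Longrightarrow> Cod Q f \<in> Obj Q"
    and Idn_Hom: "X \<in> Obj Q \<Longrightarrow> \<one>X \<in> carrier (Hom Q X X)"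
    and Comp_Hom: "\<lbrakk>f \<in> carrier (Hom Q X Y); g \<in> carrier (Hom Q Y Z)\<rbrakk>
      \<Longrightarrow> g \<cdot> f \<in> carrier (Hom Q X Z)"
    and Comp_assoc: "\<lbrakk>f \<in> carrier (Hom Q W X); g \<in> carrier (Hom Q X Y); h \<in> carrier (Hom Q Y Z)\<rbrakk>
      \<Longrightarrow> (h \<cdot> g) \<cdot> f = h \<cdot> (g \<cdot> f)"
    and Idn_left: "f \<in> carrier (Hom Q X Y) \<Longrightarrow> \<one>Y \<cdot> f = f"
    and Idn_right: "f \<in> carrier (Hom Q X Y) \<Longrightarrow> f \<cdot> \<one>X = f"
    and Hom_sup_lattice: "\<lbrakk>X \<in> Obj Q; Y \<in> Obj Q\<rbrakk> \<Longrightarrow> sup_lattice (Hom Q X Y)"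
    and Comp_Sup_right: "\<lbrakk>X \<in> Obj Q; S \<subseteq> carrier (Hom Q X Y); g \<in> carrier (Hom Q Y Z)\<rbrakk>
      \<Longrightarrow> g \<cdot> \<Squnion>\<^bsub>Hom Q X Y\<^esub> S = \<Squnion>\<^bsub>Hom Q X Z\<^esub> ((\<lambda>f. g \<cdot> f) ` S)"
    and Comp_Sup_left: "\<lbrakk>Z \<in> Obj Q; S \<subseteq> carrier (Hom Q Y Z); f \<in> carrier (Hom Q X Y)\<rbrakk>
      \<Longrightarrow> \<Squnion>\<^bsub>Hom Q Y Z\<^esub> S \<cdot> f = \<Squnion>\<^bsub>Hom Q X Z\<^esub> ((\<lambda>g. g \<cdot> f) ` S)"


section \<open>Categories enriched in a quantaloid, and distributors\<close>

text \<open>\<open>Ar A (a', a)\<close> is the hom-arrow from \<open>Ty A a\<close> to \<open>Ty A a'\<close>. Families of arrows are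
  extensional functions (via \<open>Pi\<^sub>E\<close>), so that equality of families is equality of functions.\<close>

record ('o, 'm, 'a) qcat =
  Ob :: "'a set"
  Ty :: "'a \<Rightarrow> 'o"
  Ar :: "'a \<times> 'a \<Rightarrow> 'm"

definition qcategory :: "('o, 'm) quantaloid \<Rightarrow> ('o, 'm, 'a) qcat \<Rightarrow> bool" where
  "qcategory Q A \<longleftrightarrow>
     Ty A \<in> Ob A \<rightarrow> Obj Q \<and>
     Ar A \<in> (\<Pi>\<^sub>E (a', a) \<in> Ob A \<times> Ob A. carrier (Hom Q (Ty A a) (Ty A a'))) \<and>
     (\<forall>a\<in>Ob A. \<forall>a'\<in>Ob A. \<forall>a''\<in>Ob A. Ar A (a'', a') \<cdot>\<^bsub>Q\<^esub> Ar A (a', a) \<preceq>\<^bsub>Q\<^esub> Ar A (a'', a)) \<and>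
     (\<forall>a\<in>Ob A. \<one>\<^bsub>Q\<^esub>(Ty A a) \<preceq>\<^bsub>Q\<^esub> Ar A (a, a))"

definition distributor ::
  "('o, 'm) quantaloid \<Rightarrow> ('o, 'm, 'a) qcat \<Rightarrow> ('o, 'm, 'b) qcat \<Rightarrow> ('b \<times> 'a \<Rightarrow> 'm) \<Rightarrow> bool" where
  "distributor Q A B \<Phi> \<longleftrightarrow>
     \<Phi> \<in> (\<Pi>\<^sub>E (b, a) \<in> Ob B \<times> Ob A. carrier (Hom Q (Ty A a) (Ty B b))) \<and>
     (\<forall>a\<in>Ob A. \<forall>b\<in>Ob B. \<forall>b'\<in>Ob B. Ar B (b', b) \<cdot>\<^bsub>Q\<^esub> \<Phi> (b, a) \<preceq>\<^bsub>Q\<^esub> \<Phi> (b', a)) \<and>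
     (\<forall>a\<in>Ob A. \<forall>a'\<in>Ob A. \<forall>b\<in>Ob B. \<Phi> (b, a) \<cdot>\<^bsub>Q\<^esub> Ar A (a, a') \<preceq>\<^bsub>Q\<^esub> \<Phi> (b, a'))"


section \<open>The quantaloid of distributors\<close>

text \<open>\<open>Dist(Q)\<close> is given by its hom-orders \<open>Dist Q A B\<close>, its composition \<open>dist_comp\<close> and its
  identities \<open>Ar A\<close>. It cannot be a single \<open>quantaloid\<close> record, since its objects may have
  carriers of different types.\<close>

definition Dist ::
  "('o, 'm) quantaloid \<Rightarrow> ('o, 'm, 'a) qcat \<Rightarrow> ('o, 'm, 'b) qcat \<Rightarrow> ('b \<times> 'a \<Rightarrow> 'm) gorder" where
  "Dist Q A B =
     \<lparr>carrier = {\<Phi>. distributor Q A B \<Phi>}, eq = (=),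
      le = (\<lambda>\<Phi> \<Psi>. \<forall>b\<in>Ob B. \<forall>a\<in>Ob A. \<Phi> (b, a) \<preceq>\<^bsub>Q\<^esub> \<Psi> (b, a))\<rparr>"

definition dist_comp ::
  "('o, 'm) quantaloid \<Rightarrow> ('o, 'm, 'a) qcat \<Rightarrow> ('o, 'm, 'b) qcat \<Rightarrow> ('o, 'm, 'c) qcat
     \<Rightarrow> ('c \<times> 'b \<Rightarrow> 'm) \<Rightarrow> ('b \<times> 'a \<Rightarrow> 'm) \<Rightarrow> ('c \<times> 'a \<Rightarrow> 'm)" where
  "dist_comp Q A B C \<Psi> \<Phi> =
     (\<lambda>(c, a) \<in> Ob C \<times> Ob A.
        \<Squnion>\<^bsub>Hom Q (Ty A a) (Ty C c)\<^esub> ((\<lambda>b. \<Psi> (c, b) \<cdot>\<^bsub>Q\<^esub> \<Phi> (b, a)) ` Ob B))"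

text \<open>\<open>dist_lift Q A B C \<Gamma> H\<close> is \<open>[\<Gamma>, H]\<close> and \<open>dist_ext Q A B C \<Phi> H\<close> is \<open>{\<Phi>, H}\<close>, where
  \<open>\<Phi>\<close> goes from \<open>A\<close> to \<open>B\<close>, \<open>\<Gamma>\<close> from \<open>B\<close> to \<open>C\<close>, and \<open>H\<close> from \<open>A\<close> to \<open>C\<close>.\<close>

definition dist_lift ::
  "('o, 'm) quantaloid \<Rightarrow> ('o, 'm, 'a) qcat \<Rightarrow> ('o, 'm, 'b) qcat \<Rightarrow> ('o, 'm, 'c) qcat
     \<Rightarrow> ('c \<times> 'b \<Rightarrow> 'm) \<Rightarrow> ('c \<times> 'a \<Rightarrow> 'm) \<Rightarrow> ('b \<times> 'a \<Rightarrow> 'm)" where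
  "dist_lift Q A B C \<Gamma> H =
     (THE \<Xi>. greatest (Dist Q A B) \<Xi>
        {\<Xi> \<in> carrier (Dist Q A B). dist_comp Q A B C \<Gamma> \<Xi> \<sqsubseteq>\<^bsub>Dist Q A C\<^esub> H})"

definition dist_ext ::
  "('o, 'm) quantaloid \<Rightarrow> ('o, 'm, 'a) qcat \<Rightarrow> ('o, 'm, 'b) qcat \<Rightarrow> ('o, 'm, 'c) qcat
     \<Rightarrow> ('b \<times> 'a \<Rightarrow> 'm) \<Rightarrow> ('c \<times> 'a \<Rightarrow> 'm) \<Rightarrow> ('c \<times> 'b \<Rightarrow> 'm)" where
  "dist_ext Q A B C \<Phi> H =
     (THE \<Upsilon>. greatest (Dist Q B C) \<Upsilon>
        {\<Upsilon> \<in> carrier (Dist Q B C). dist_comp Q A B C \<Upsilon> \<Phi> \<sqsubseteq>\<^bsub>Dist Q A C\<^esub> H})"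

definition dist_adjoint ::
  "('o, 'm) quantaloid \<Rightarrow> ('o, 'm, 'a) qcat \<Rightarrow> ('o, 'm, 'b) qcat
     \<Rightarrow> ('b \<times> 'a \<Rightarrow> 'm) \<Rightarrow> ('a \<times> 'b \<Rightarrow> 'm) \<Rightarrow> bool" where
  "dist_adjoint Q A B \<Phi> \<Psi> \<longleftrightarrow>
     \<Phi> \<in> carrier (Dist Q A B) \<and> \<Psi> \<in> carrier (Dist Q B A) \<and>
     Ar A \<sqsubseteq>\<^bsub>Dist Q A A\<^esub> dist_comp Q A B A \<Psi> \<Phi> \<and>
     dist_comp Q B A B \<Phi> \<Psi> \<sqsubseteq>\<^bsub>Dist Q B B\<^esub> Ar B"

definition dist_isomorphic ::
  "('o, 'm) quantaloid \<Rightarrow> ('o, 'm, 'a) qcat \<Rightarrow> ('o, 'm, 'b) qcat \<Rightarrow> bool" where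
  "dist_isomorphic Q A B \<longleftrightarrow>
     (\<exists>\<Phi> \<in> carrier (Dist Q A B). \<exists>\<Psi> \<in> carrier (Dist Q B A).
        dist_comp Q A B A \<Psi> \<Phi> = Ar A \<and> dist_comp Q B A B \<Phi> \<Psi> = Ar B)"


section \<open>Functors\<close>

definition qfunctor ::
  "('o, 'm) quantaloid \<Rightarrow> ('o, 'm, 'a) qcat \<Rightarrow> ('o, 'm, 'b) qcat \<Rightarrow> ('a \<Rightarrow> 'b) \<Rightarrow> bool" where
  "qfunctor Q A B F \<longleftrightarrow>
     F \<in> Ob A \<rightarrow>\<^sub>E Ob B \<and>
     (\<forall>a\<in>Ob A. Ty B (F a) = Ty A a) \<and>
     (\<forall>a\<in>Ob A. \<forall>a'\<in>Ob A. Ar A (a', a) \<preceq>\<^bsub>Q\<^esub> Ar B (F a', F a))"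

definition qfunctor_le ::
  "('o, 'm) quantaloid \<Rightarrow> ('o, 'm, 'a) qcat \<Rightarrow> ('o, 'm, 'b) qcat \<Rightarrow> ('a \<Rightarrow> 'b) \<Rightarrow> ('a \<Rightarrow> 'b) \<Rightarrow> bool" where
  "qfunctor_le Q A B F G \<longleftrightarrow> (\<forall>a\<in>Ob A. \<one>\<^bsub>Q\<^esub>(Ty A a) \<preceq>\<^bsub>Q\<^esub> Ar B (F a, G a))"

definition qfunctor_iso ::
  "('o, 'm) quantaloid \<Rightarrow> ('o, 'm, 'a) qcat \<Rightarrow> ('o, 'm, 'b) qcat \<Rightarrow> ('a \<Rightarrow> 'b) \<Rightarrow> ('a \<Rightarrow> 'b) \<Rightarrow> bool" where
  "qfunctor_iso Q A B F G \<longleftrightarrow> qfunctor_le Q A B F G \<and> qfunctor_le Q A B G F"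

definition qcat_equivalent ::
  "('o, 'm) quantaloid \<Rightarrow> ('o, 'm, 'a) qcat \<Rightarrow> ('o, 'm, 'b) qcat \<Rightarrow> bool" where
  "qcat_equivalent Q A B \<longleftrightarrow>
     (\<exists>F G. qfunctor Q A B F \<and> qfunctor Q B A G \<and>
        qfunctor_iso Q A A (compose (Ob A) G F) (\<lambda>a\<in>Ob A. a) \<and>
        qfunctor_iso Q B B (compose (Ob B) F G) (\<lambda>b\<in>Ob B. b))"


section \<open>Presheaves and Cauchy completion\<close>

definition star :: "('o, 'm) quantaloid \<Rightarrow> 'o \<Rightarrow> ('o, 'm, unit) qcat" where
  "star Q X = \<lparr>Ob = {()}, Ty = (\<lambda>_. X), Ar = (\<lambda>_. \<one>\<^bsub>Q\<^esub>X)\<rparr>"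

text \<open>An object of type \<open>X\<close> of \<open>presheaves Q A\<close> or \<open>copresheaves Q A\<close> is a pair \<open>(X, \<phi>)\<close>; the
  type has to be recorded, because for empty \<open>A\<close> it is not determined by the family \<open>\<phi>\<close>.\<close>

definition presheaves ::
  "('o, 'm) quantaloid \<Rightarrow> ('o, 'm, 'a) qcat \<Rightarrow> ('o, 'm, 'o \<times> ('a \<times> unit \<Rightarrow> 'm)) qcat" where
  "presheaves Q A =
     (let P = {(X, \<phi>). X \<in> Obj Q \<and> distributor Q (star Q X) A \<phi>} in
      \<lparr>Ob = P, Ty = fst,
       Ar = (\<lambda>((Y, \<psi>), (X, \<phi>)) \<in> P \<times> P. dist_lift Q (star Q X) (star Q Y) A \<psi> \<phi> ((), ()))\<rparr>)"

definition copresheaves ::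
  "('o, 'm) quantaloid \<Rightarrow> ('o, 'm, 'a) qcat \<Rightarrow> ('o, 'm, 'o \<times> (unit \<times> 'a \<Rightarrow> 'm)) qcat" where
  "copresheaves Q A =
     (let P = {(X, \<phi>). X \<in> Obj Q \<and> distributor Q A (star Q X) \<phi>} in
      \<lparr>Ob = P, Ty = fst,
       Ar = (\<lambda>((Y, \<psi>), (X, \<phi>)) \<in> P \<times> P. dist_ext Q A (star Q X) (star Q Y) \<phi> \<psi> ((), ()))\<rparr>)"

definition full_subcategory :: "('o, 'm, 'a) qcat \<Rightarrow> 'a set \<Rightarrow> ('o, 'm, 'a) qcat" where
  "full_subcategory A S = \<lparr>Ob = S, Ty = Ty A, Ar = restrict (Ar A) (S \<times> S)\<rparr>"

definition cauchy_completion ::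
  "('o, 'm) quantaloid \<Rightarrow> ('o, 'm, 'a) qcat \<Rightarrow> ('o, 'm, 'o \<times> ('a \<times> unit \<Rightarrow> 'm)) qcat" where
  "cauchy_completion Q A =
     full_subcategory (presheaves Q A)
       {(X, \<phi>) \<in> Ob (presheaves Q A). \<exists>\<psi>. dist_adjoint Q (star Q X) A \<phi> \<psi>}"

end

theory Submission
  imports Defs
begin

text \<open>
  Restricting a functor between presheaf categories to the representables yields a distributor, and
  a distributor acts on presheaves. These two passages relate isomorphism in \<open>Dist(Q)\<close> to
  equivalence of presheaf categories and of Cauchy completions.

  From distributors to functors, \<open>\<Phi>\<close> acts on presheaves by \<open>\<phi> \<mapsto> \<Phi> \<otimes> \<phi>\<close>
  (\<open>pushforward\<close>). This is functorial in \<open>\<phi>\<close> and compatible with composition of distributors,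
  so that mutually inverse distributors give mutually inverse functors between \<open>P A\<close> and
  \<open>P B\<close>. An invertible distributor is a left adjoint, and left adjoints compose, so these
  functors restrict to the Cauchy completions.

  From functors to distributors, let \<open>F\<close> and \<open>G\<close> be an equivalence between full subcategories
  of \<open>P A\<close> and \<open>P B\<close> that contain the representables, and put
  \<open>\<Phi>(b, a) = F(y a)(b)\<close> and \<open>\<Psi>(a, b) = G(y b)(a)\<close>. The equivalence is an adjunction,
  \<open>P B (F p, q) = P A (p, G q)\<close>, and presheaf categories are skeletal, so \<open>G (F p) = p\<close>.
  With the Yoneda lemma, \<open>\<Psi>(a', b) = P B (F(y a'), y b)\<close> and
  \<open>\<Phi>(b, a) = P B (y b, F(y a))\<close>; composition in \<open>P B\<close> then gives \<open>\<Psi> \<otimes> \<Phi> \<le> A\<close>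
  (\<open>comp_le\<close>). The reverse inequality has a different reason in each case:

  \<^item> for all presheaves, the adjunction shows that \<open>G q \<le> \<Psi> \<otimes> q\<close>, because \<open>\<Psi> \<otimes> q\<close>
    is itself available as an object to test against (\<open>F_le_pushforward\<close>, applied to the reversed
    equivalence); for \<open>q = F(y a)\<close> this reads \<open>A \<le> \<Psi> \<otimes> \<Phi>\<close>;

  \<^item> for Cauchy completions, \<open>\<Psi> \<otimes> q\<close> need not be an object for arbitrary \<open>q\<close>, but
    \<open>p = F(y a')\<close> has a right adjoint, which forces
    \<open>P B (p, q) \<le> \<Squnion> b. P B (p, y b) \<cdot> q b\<close> (\<open>cauchy_density\<close>).

  The case of copresheaves is that of presheaves for the opposite quantaloid: copresheaves on
  \<open>A\<close> over \<open>Q\<close> are presheaves on the opposite of \<open>A\<close> over the opposite of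
  \<open>Q\<close>, with hom-arrows reversed, and isomorphism in \<open>Dist(Q)\<close> is a self-dual notion.
\<close>

section \<open>Order and composition in a quantaloid\<close>

context quantaloid
begin

abbreviation hom :: "'o \<Rightarrow> 'o \<Rightarrow> 'm set" where
  "hom X Y \<equiv> carrier (Hom Q X Y)"

lemma hom_Obj: "f \<in> hom X Y \<Longrightarrow> X \<in> Obj Q" "f \<in> hom X Y \<Longrightarrow> Y \<in> Obj Q"
  using Dom_Obj Cod_Obj by (auto simp: Hom_def)

lemma Hom_partial_order: "f \<in> hom X Y \<Longrightarrow> partial_order (Hom Q X Y)"
  using Hom_sup_lattice hom_Obj sup_lattice.axioms(1) by blast

lemma le_refl: "f \<in> hom X Y \<Longrightarrow> f \<preceq> f"
proof -
  assume f: "f \<in> hom X Y"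
  interpret partial_order "Hom Q X Y" by (rule Hom_partial_order[OF f])
  show ?thesis using local.le_refl[OF f] by (simp add: Hom_def)
qed

lemma le_trans:
  assumes "f \<preceq> g" "g \<preceq> h" "f \<in> hom X Y" "g \<in> hom X Y" "h \<in> hom X Y"
  shows "f \<preceq> h"
proof -
  interpret partial_order "Hom Q X Y" by (rule Hom_partial_order[OF assms(3)])
  show ?thesis using local.le_trans[of f g h] assms by (simp add: Hom_def)
qed

lemma le_antisym:
  assumes "f \<preceq> g" "g \<preceq> f" "f \<in> hom X Y" "g \<in> hom X Y"
  shows "f = g"
proof -
  interpret partial_order "Hom Q X Y" by (rule Hom_partial_order[OF assms(3)])
  show ?thesis using local.le_antisym[of f g] assms by (simp add: Hom_def)
qed

lemma Sup_is_least:
  assumes "X \<in> Obj Q" "Y \<in> Obj Q" "S \<subseteq> hom X Y"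
  shows "least (Hom Q X Y) (\<Squnion>\<^bsub>Hom Q X Y\<^esub> S) (Upper (Hom Q X Y) S)"
proof -
  interpret sup_lattice "Hom Q X Y" by (rule Hom_sup_lattice[OF assms(1,2)])
  show ?thesis using sup_exists[OF assms(3)] unfolding sup_def by (rule someI_ex)
qed

lemma Sup_hom:
  assumes "X \<in> Obj Q" "Y \<in> Obj Q" "S \<subseteq> hom X Y"
  shows "\<Squnion>\<^bsub>Hom Q X Y\<^esub> S \<in> hom X Y"
  using Sup_is_least[OF assms] by (simp add: least_def Upper_def)

lemma Sup_upper:
  assumes "X \<in> Obj Q" "Y \<in> Obj Q" "S \<subseteq> hom X Y" "f \<in> S"
  shows "f \<preceq> \<Squnion>\<^bsub>Hom Q X Y\<^esub> S"
  using Sup_is_least[OF assms(1-3)] assms(3,4) by (auto simp: least_def Upper_def Hom_def)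

lemma Sup_least:
  assumes "S \<subseteq> hom X Y" "h \<in> hom X Y" "\<And>f. f \<in> S \<Longrightarrow> f \<preceq> h"
  shows "\<Squnion>\<^bsub>Hom Q X Y\<^esub> S \<preceq> h"
  using Sup_is_least[OF hom_Obj[OF assms(2)] assms(1)] assms by (auto simp: least_def Upper_def Hom_def)

text \<open>Monotonicity of composition is hidden in its preservation of suprema: apply the latter to a
  comparable pair, whose supremum is the larger element.\<close>

lemma Sup_pair:
  assumes "f \<preceq> f'" "f \<in> hom X Y" "f' \<in> hom X Y"
  shows "\<Squnion>\<^bsub>Hom Q X Y\<^esub> {f, f'} = f'"
  by (rule le_antisym[where X = X and Y = Y])
     (use assms hom_Obj le_refl in \<open>auto intro!: Sup_least Sup_hom Sup_upper\<close>)

lemma comp_mono_right: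
  assumes "f \<preceq> f'" "f \<in> hom X Y" "f' \<in> hom X Y" "g \<in> hom Y Z"
  shows "g \<cdot> f \<preceq> g \<cdot> f'"
proof -
  have "g \<cdot> f' = \<Squnion>\<^bsub>Hom Q X Z\<^esub> {g \<cdot> f, g \<cdot> f'}"
    using Comp_Sup_right[of X "{f, f'}" Y g Z] assms hom_Obj Sup_pair[OF assms(1-3)] by simp
  then show ?thesis
    using Sup_upper[of X Z "{g \<cdot> f, g \<cdot> f'}" "g \<cdot> f"] Comp_Hom assms hom_Obj by simp
qed

lemma comp_mono_left:
  assumes "g \<preceq> g'" "g \<in> hom Y Z" "g' \<in> hom Y Z" "f \<in> hom X Y"
  shows "g \<cdot> f \<preceq> g' \<cdot> f"
proof -
  have "g' \<cdot> f = \<Squnion>\<^bsub>Hom Q X Z\<^esub> {g \<cdot> f, g' \<cdot> f}"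
    using Comp_Sup_left[of Z "{g, g'}" Y f X] assms hom_Obj Sup_pair[OF assms(1-3)] by simp
  then show ?thesis
    using Sup_upper[of X Z "{g \<cdot> f, g' \<cdot> f}" "g \<cdot> f"] Comp_Hom assms hom_Obj by simp
qed

lemma comp_mono:
  assumes "g \<preceq> g'" "f \<preceq> f'" "f \<in> hom X Y" "f' \<in> hom X Y" "g \<in> hom Y Z" "g' \<in> hom Y Z"
  shows "g \<cdot> f \<preceq> g' \<cdot> f'"
  by (rule le_trans[OF comp_mono_left comp_mono_right])
     (use assms Comp_Hom in blast)+

lemma comp_Sup_le:
  assumes "S \<subseteq> hom X Y" "g \<in> hom Y Z" "h \<in> hom X Z" "\<And>f. f \<in> S \<Longrightarrow> g \<cdot> f \<preceq> h"
  shows "g \<cdot> \<Squnion>\<^bsub>Hom Q X Y\<^esub> S \<preceq> h"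
  unfolding Comp_Sup_right[OF hom_Obj(1)[OF assms(3)] assms(1,2)]
  by (rule Sup_least) (use assms Comp_Hom in blast)+

lemma Sup_comp_le:
  assumes "S \<subseteq> hom Y Z" "f \<in> hom X Y" "h \<in> hom X Z" "\<And>g. g \<in> S \<Longrightarrow> g \<cdot> f \<preceq> h"
  shows "\<Squnion>\<^bsub>Hom Q Y Z\<^esub> S \<cdot> f \<preceq> h"
  unfolding Comp_Sup_left[OF hom_Obj(2)[OF assms(3)] assms(1,2)]
  by (rule Sup_least) (use assms Comp_Hom in blast)+

section \<open>Distributors and their composition\<close>

lemma qcategory_Obj: "qcategory Q A \<Longrightarrow> a \<in> Ob A \<Longrightarrow> Ty A a \<in> Obj Q"
  by (auto simp: qcategory_def)

lemma qcategory_hom: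
  "qcategory Q A \<Longrightarrow> a \<in> Ob A \<Longrightarrow> a' \<in> Ob A \<Longrightarrow> Ar A (a', a) \<in> hom (Ty A a) (Ty A a')"
  by (force simp: qcategory_def PiE_def Pi_def)

lemma qcategory_comp:
  "qcategory Q A \<Longrightarrow> a \<in> Ob A \<Longrightarrow> a' \<in> Ob A \<Longrightarrow> a'' \<in> Ob A \<Longrightarrow>
   Ar A (a'', a') \<cdot> Ar A (a', a) \<preceq> Ar A (a'', a)"
  by (auto simp: qcategory_def)

lemma qcategory_id: "qcategory Q A \<Longrightarrow> a \<in> Ob A \<Longrightarrow> \<one>(Ty A a) \<preceq> Ar A (a, a)"
  by (auto simp: qcategory_def)

lemma distributor_hom:
  "distributor Q A B \<Phi> \<Longrightarrow> a \<in> Ob A \<Longrightarrow> b \<in> Ob B \<Longrightarrow> \<Phi> (b, a) \<in> hom (Ty A a) (Ty B b)"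
  by (force simp: distributor_def PiE_def Pi_def)

lemma distributor_left:
  "distributor Q A B \<Phi> \<Longrightarrow> a \<in> Ob A \<Longrightarrow> b \<in> Ob B \<Longrightarrow> b' \<in> Ob B \<Longrightarrow>
   Ar B (b', b) \<cdot> \<Phi> (b, a) \<preceq> \<Phi> (b', a)"
  by (auto simp: distributor_def)

lemma distributor_right:
  "distributor Q A B \<Phi> \<Longrightarrow> a \<in> Ob A \<Longrightarrow> a' \<in> Ob A \<Longrightarrow> b \<in> Ob B \<Longrightarrow>
   \<Phi> (b, a) \<cdot> Ar A (a, a') \<preceq> \<Phi> (b, a')"
  by (auto simp: distributor_def)

lemma distributorI:
  assumes "\<Phi> \<in> extensional (Ob B \<times> Ob A)"
    "\<And>a b. a \<in> Ob A \<Longrightarrow> b \<in> Ob B \<Longrightarrow> \<Phi> (b, a) \<in> hom (Ty A a) (Ty B b)"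
    "\<And>a b b'. a \<in> Ob A \<Longrightarrow> b \<in> Ob B \<Longrightarrow> b' \<in> Ob B \<Longrightarrow> Ar B (b', b) \<cdot> \<Phi> (b, a) \<preceq> \<Phi> (b', a)"
    "\<And>a a' b. a \<in> Ob A \<Longrightarrow> a' \<in> Ob A \<Longrightarrow> b \<in> Ob B \<Longrightarrow> \<Phi> (b, a) \<cdot> Ar A (a, a') \<preceq> \<Phi> (b, a')"
  shows "distributor Q A B \<Phi>"
  unfolding distributor_def PiE_def using assms by auto

lemma distributor_eqI:
  assumes "distributor Q A B \<Phi>" "distributor Q A B \<Phi>'"
    "\<And>a b. a \<in> Ob A \<Longrightarrow> b \<in> Ob B \<Longrightarrow> \<Phi> (b, a) \<preceq> \<Phi>' (b, a)"
    "\<And>a b. a \<in> Ob A \<Longrightarrow> b \<in> Ob B \<Longrightarrow> \<Phi>' (b, a) \<preceq> \<Phi> (b, a)"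
  shows "\<Phi> = \<Phi>'"
proof (rule extensionalityI)
  show "\<Phi> \<in> extensional (Ob B \<times> Ob A)" "\<Phi>' \<in> extensional (Ob B \<times> Ob A)"
    using assms(1,2) by (auto simp: distributor_def PiE_def)
  fix p assume "p \<in> Ob B \<times> Ob A"
  then obtain a b where p: "p = (b, a)" "a \<in> Ob A" "b \<in> Ob B" by blast
  show "\<Phi> p = \<Phi>' p"
    unfolding p(1) by (rule le_antisym[OF assms(3,4)[OF p(2,3)] distributor_hom[OF assms(1) p(2,3)]
          distributor_hom[OF assms(2) p(2,3)]])
qed

lemma qcategory_distributor: "qcategory Q A \<Longrightarrow> distributor Q A A (Ar A)"
  by (auto simp: qcategory_def distributor_def)

lemma carrier_Dist [simp]: "\<Phi> \<in> carrier (Dist Q A B) \<longleftrightarrow> distributor Q A B \<Phi>"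
  by (simp add: Dist_def)

lemma le_Dist [simp]:
  "\<Phi> \<sqsubseteq>\<^bsub>Dist Q A B\<^esub> \<Psi> \<longleftrightarrow> (\<forall>b\<in>Ob B. \<forall>a\<in>Ob A. \<Phi> (b, a) \<preceq> \<Psi> (b, a))"
  by (simp add: Dist_def)

lemma star_simps [simp]: "Ob (star Q X) = {()}" "Ty (star Q X) u = X" "Ar (star Q X) p = \<one>X"
  by (simp_all add: star_def)

lemma star_qcategory: "X \<in> Obj Q \<Longrightarrow> qcategory Q (star Q X)"
  using Idn_Hom Idn_left le_refl
  by (fastforce simp: qcategory_def PiE_def extensional_def)

context
  fixes A :: "('o,'m,'x) qcat" and B :: "('o,'m,'y) qcat" and C :: "('o,'m,'z) qcat"
    and \<Phi> \<Psi> and a c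
  assumes PhiPsi: "distributor Q A B \<Phi>" "distributor Q B C \<Psi>"
    and ac: "a \<in> Ob A" "c \<in> Ob C" and Tyac: "Ty A a \<in> Obj Q" "Ty C c \<in> Obj Q"
begin

private lemma terms:
  "(\<lambda>b. \<Psi> (c, b) \<cdot> \<Phi> (b, a)) ` Ob B \<subseteq> hom (Ty A a) (Ty C c)"
  using distributor_hom[OF PhiPsi(1) ac(1)] distributor_hom[OF PhiPsi(2) _ ac(2)] Comp_Hom by blast

lemma dist_comp_hom: "dist_comp Q A B C \<Psi> \<Phi> (c, a) \<in> hom (Ty A a) (Ty C c)"
  using Sup_hom[OF Tyac terms] ac by (simp add: dist_comp_def)

lemma dist_comp_upper: "b \<in> Ob B \<Longrightarrow> \<Psi> (c, b) \<cdot> \<Phi> (b, a) \<preceq> dist_comp Q A B C \<Psi> \<Phi> (c, a)"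
  using Sup_upper[OF Tyac terms] ac by (simp add: dist_comp_def)

lemma dist_comp_least:
  assumes "h \<in> hom (Ty A a) (Ty C c)" "\<And>b. b \<in> Ob B \<Longrightarrow> \<Psi> (c, b) \<cdot> \<Phi> (b, a) \<preceq> h"
  shows "dist_comp Q A B C \<Psi> \<Phi> (c, a) \<preceq> h"
  using Sup_least[OF terms] assms ac by (auto simp: dist_comp_def)

lemma dist_comp_le_right:
  assumes "f \<in> hom X (Ty A a)" "h \<in> hom X (Ty C c)"
    "\<And>b. b \<in> Ob B \<Longrightarrow> \<Psi> (c, b) \<cdot> (\<Phi> (b, a) \<cdot> f) \<preceq> h"
  shows "dist_comp Q A B C \<Psi> \<Phi> (c, a) \<cdot> f \<preceq> h"
proof -
  have "(\<Psi> (c, b) \<cdot> \<Phi> (b, a)) \<cdot> f \<preceq> h" if "b \<in> Ob B" for b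
    using assms(3)[OF that]
      Comp_assoc[OF assms(1) distributor_hom[OF PhiPsi(1) ac(1) that] distributor_hom[OF PhiPsi(2) that ac(2)]]
    by simp
  then show ?thesis using ac Sup_comp_le[OF terms assms(1,2)] by (auto simp: dist_comp_def)
qed

lemma dist_comp_le_left:
  assumes "f \<in> hom (Ty C c) Y" "h \<in> hom (Ty A a) Y"
    "\<And>b. b \<in> Ob B \<Longrightarrow> (f \<cdot> \<Psi> (c, b)) \<cdot> \<Phi> (b, a) \<preceq> h"
  shows "f \<cdot> dist_comp Q A B C \<Psi> \<Phi> (c, a) \<preceq> h"
proof -
  have "f \<cdot> (\<Psi> (c, b) \<cdot> \<Phi> (b, a)) \<preceq> h" if "b \<in> Ob B" for b
    using assms(3)[OF that]
      Comp_assoc[OF distributor_hom[OF PhiPsi(1) ac(1) that] distributor_hom[OF PhiPsi(2) that ac(2)] assms(1)]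
    by simp
  then show ?thesis using ac comp_Sup_le[OF terms assms(1,2)] by (auto simp: dist_comp_def)
qed

end


lemma dist_comp_mono:
  assumes \<Phi>: "distributor Q A B \<Phi>" "distributor Q A B \<Phi>'"
    and \<Psi>: "distributor Q B C \<Psi>" "distributor Q B C \<Psi>'"
    and ac: "a \<in> Ob A" "c \<in> Ob C" "Ty A a \<in> Obj Q" "Ty C c \<in> Obj Q"
    and le: "\<And>b. b \<in> Ob B \<Longrightarrow> \<Phi> (b, a) \<preceq> \<Phi>' (b, a)" "\<And>b. b \<in> Ob B \<Longrightarrow> \<Psi> (c, b) \<preceq> \<Psi>' (c, b)"
  shows "dist_comp Q A B C \<Psi> \<Phi> (c, a) \<preceq> dist_comp Q A B C \<Psi>' \<Phi>' (c, a)"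
proof (rule dist_comp_least[OF \<Phi>(1) \<Psi>(1) ac dist_comp_hom[OF \<Phi>(2) \<Psi>(2) ac]])
  fix b assume b: "b \<in> Ob B"
  note homs = distributor_hom[OF \<Phi>(1) ac(1) b] distributor_hom[OF \<Phi>(2) ac(1) b]
    distributor_hom[OF \<Psi>(1) b ac(2)] distributor_hom[OF \<Psi>(2) b ac(2)]
  show "\<Psi> (c, b) \<cdot> \<Phi> (b, a) \<preceq> dist_comp Q A B C \<Psi>' \<Phi>' (c, a)"
    by (rule le_trans[OF comp_mono[OF le(2)[OF b] le(1)[OF b] homs] dist_comp_upper[OF \<Phi>(2) \<Psi>(2) ac b]])
      (rule Comp_Hom homs dist_comp_hom[OF \<Phi>(2) \<Psi>(2) ac])+
qed

lemma dist_comp_distributor: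
  assumes A: "qcategory Q A" and C: "qcategory Q C"
    and \<Phi>: "distributor Q A B \<Phi>" and \<Psi>: "distributor Q B C \<Psi>"
  shows "distributor Q A C (dist_comp Q A B C \<Psi> \<Phi>)"
proof (rule distributorI)
  show "dist_comp Q A B C \<Psi> \<Phi> \<in> extensional (Ob C \<times> Ob A)"
    by (simp add: dist_comp_def)
  note ob = qcategory_Obj[OF A] qcategory_Obj[OF C]
  note h = distributor_hom[OF \<Phi>] distributor_hom[OF \<Psi>]
  show hom: "dist_comp Q A B C \<Psi> \<Phi> (c, a) \<in> hom (Ty A a) (Ty C c)" if "a \<in> Ob A" "c \<in> Ob C" for a c
    using dist_comp_hom[OF \<Phi> \<Psi> that] ob that by simp
  show "Ar C (c', c) \<cdot> dist_comp Q A B C \<Psi> \<Phi> (c, a) \<preceq> dist_comp Q A B C \<Psi> \<Phi> (c', a)"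
    if a: "a \<in> Ob A" and c: "c \<in> Ob C" and c': "c' \<in> Ob C" for a c c'
  proof (rule dist_comp_le_left[OF \<Phi> \<Psi> a c ob(1)[OF a] ob(2)[OF c] qcategory_hom[OF C c c'] hom[OF a c']])
    fix b assume b: "b \<in> Ob B"
    note homs = h(1)[OF a b] h(2)[OF b c] h(2)[OF b c'] qcategory_hom[OF C c c'] hom[OF a c']
    show "Ar C (c', c) \<cdot> \<Psi> (c, b) \<cdot> \<Phi> (b, a) \<preceq> dist_comp Q A B C \<Psi> \<Phi> (c', a)"
      by (rule le_trans[OF comp_mono_left[OF distributor_left[OF \<Psi> b c c']]
            dist_comp_upper[OF \<Phi> \<Psi> a c' ob(1)[OF a] ob(2)[OF c'] b]])
        (rule Comp_Hom homs)+
  qed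
  show "dist_comp Q A B C \<Psi> \<Phi> (c, a) \<cdot> Ar A (a, a') \<preceq> dist_comp Q A B C \<Psi> \<Phi> (c, a')"
    if a: "a \<in> Ob A" and a': "a' \<in> Ob A" and c: "c \<in> Ob C" for a a' c
  proof (rule dist_comp_le_right[OF \<Phi> \<Psi> a c ob(1)[OF a] ob(2)[OF c] qcategory_hom[OF A a' a] hom[OF a' c]])
    fix b assume b: "b \<in> Ob B"
    note homs = h(1)[OF a b] h(1)[OF a' b] h(2)[OF b c] qcategory_hom[OF A a' a] hom[OF a' c]
    show "\<Psi> (c, b) \<cdot> (\<Phi> (b, a) \<cdot> Ar A (a, a')) \<preceq> dist_comp Q A B C \<Psi> \<Phi> (c, a')"
      by (rule le_trans[OF comp_mono_right[OF distributor_right[OF \<Phi> a a' b]]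
            dist_comp_upper[OF \<Phi> \<Psi> a' c ob(1)[OF a'] ob(2)[OF c] b]])
        (rule Comp_Hom homs)+
  qed
qed

lemma dist_comp_assoc:
  assumes A: "qcategory Q A" and B: "qcategory Q B" and C: "qcategory Q C" and D: "qcategory Q D"
    and \<Phi>: "distributor Q A B \<Phi>" and \<Psi>: "distributor Q B C \<Psi>" and \<Xi>: "distributor Q C D \<Xi>"
  shows "dist_comp Q A B D (dist_comp Q B C D \<Xi> \<Psi>) \<Phi> = dist_comp Q A C D \<Xi> (dist_comp Q A B C \<Psi> \<Phi>)"
    (is "?L = ?R")
proof -
  note \<Psi>\<Phi> = dist_comp_distributor[OF A C \<Phi> \<Psi>]
  note \<Xi>\<Psi> = dist_comp_distributor[OF B D \<Psi> \<Xi>]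
  note L = dist_comp_distributor[OF A D \<Phi> \<Xi>\<Psi>]
  note R = dist_comp_distributor[OF A D \<Psi>\<Phi> \<Xi>]
  show ?thesis
  proof (rule distributor_eqI[OF L R])
    fix a d assume a: "a \<in> Ob A" and d: "d \<in> Ob D"
    have assoc: "\<Xi> (d, c) \<cdot> \<Psi> (c, b) \<cdot> \<Phi> (b, a) = \<Xi> (d, c) \<cdot> (\<Psi> (c, b) \<cdot> \<Phi> (b, a))"
      if "b \<in> Ob B" "c \<in> Ob C" for b c
      using that a d Comp_assoc distributor_hom[OF \<Phi>] distributor_hom[OF \<Psi>] distributor_hom[OF \<Xi>] by metis
    have le_L: "\<Xi> (d, c) \<cdot> \<Psi> (c, b) \<cdot> \<Phi> (b, a) \<preceq> ?L (d, a)" if b: "b \<in> Ob B" and c: "c \<in> Ob C" for b c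
    proof -
      note homs = distributor_hom[OF \<Phi> a b] distributor_hom[OF \<Psi> b c] distributor_hom[OF \<Xi> c d]
      note ob = qcategory_Obj[OF B b] qcategory_Obj[OF D d] qcategory_Obj[OF A a]
      show ?thesis
        by (rule le_trans[OF comp_mono_left[OF dist_comp_upper[OF \<Psi> \<Xi> b d ob(1,2) c]]
              dist_comp_upper[OF \<Phi> \<Xi>\<Psi> a d ob(3,2) b]])
           (rule Comp_Hom homs distributor_hom[OF \<Xi>\<Psi> b d] distributor_hom[OF L a d])+
    qed
    have le_R: "\<Xi> (d, c) \<cdot> (\<Psi> (c, b) \<cdot> \<Phi> (b, a)) \<preceq> ?R (d, a)" if b: "b \<in> Ob B" and c: "c \<in> Ob C" for b c
    proof -
      note homs = distributor_hom[OF \<Phi> a b] distributor_hom[OF \<Psi> b c] distributor_hom[OF \<Xi> c d]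
      note ob = qcategory_Obj[OF A a] qcategory_Obj[OF C c] qcategory_Obj[OF D d]
      show ?thesis
        by (rule le_trans[OF comp_mono_right[OF dist_comp_upper[OF \<Phi> \<Psi> a c ob(1,2) b]]
              dist_comp_upper[OF \<Psi>\<Phi> \<Xi> a d ob(1,3) c]])
           (rule Comp_Hom homs distributor_hom[OF \<Psi>\<Phi> a c] distributor_hom[OF R a d])+
    qed
    note ob = a d qcategory_Obj[OF A a] qcategory_Obj[OF D d]
    show "?L (d, a) \<preceq> ?R (d, a)"
    proof (rule dist_comp_least[OF \<Phi> \<Xi>\<Psi> ob distributor_hom[OF R a d]])
      fix b assume b: "b \<in> Ob B"
      show "dist_comp Q B C D \<Xi> \<Psi> (d, b) \<cdot> \<Phi> (b, a) \<preceq> ?R (d, a)"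
      proof (rule dist_comp_le_right[OF \<Psi> \<Xi> b d qcategory_Obj[OF B b] ob(4) distributor_hom[OF \<Phi> a b]
            distributor_hom[OF R a d]])
        fix c assume c: "c \<in> Ob C"
        show "\<Xi> (d, c) \<cdot> (\<Psi> (c, b) \<cdot> \<Phi> (b, a)) \<preceq> ?R (d, a)"
          by (rule le_R[OF b c])
      qed
    qed
    show "?R (d, a) \<preceq> ?L (d, a)"
    proof (rule dist_comp_least[OF \<Psi>\<Phi> \<Xi> ob distributor_hom[OF L a d]])
      fix c assume c: "c \<in> Ob C"
      show "\<Xi> (d, c) \<cdot> dist_comp Q A B C \<Psi> \<Phi> (c, a) \<preceq> ?L (d, a)"
      proof (rule dist_comp_le_left[OF \<Phi> \<Psi> a c ob(3) qcategory_Obj[OF C c] distributor_hom[OF \<Xi> c d]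
            distributor_hom[OF L a d]])
        fix b assume b: "b \<in> Ob B"
        show "\<Xi> (d, c) \<cdot> \<Psi> (c, b) \<cdot> \<Phi> (b, a) \<preceq> ?L (d, a)"
          by (rule le_L[OF b c])
      qed
    qed
  qed
qed

lemma dist_comp_Ar_left:
  assumes A: "qcategory Q A" and B: "qcategory Q B" and \<Phi>: "distributor Q A B \<Phi>"
  shows "dist_comp Q A B B (Ar B) \<Phi> = \<Phi>"
proof (rule distributor_eqI[OF _ \<Phi>])
  note B' = qcategory_distributor[OF B]
  show d: "distributor Q A B (dist_comp Q A B B (Ar B) \<Phi>)"
    by (rule dist_comp_distributor[OF A B \<Phi> B'])
  fix a b assume a: "a \<in> Ob A" and b: "b \<in> Ob B"
  note ob = a b qcategory_Obj[OF A a] qcategory_Obj[OF B b]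
  note h = distributor_hom[OF \<Phi> a b]
  show "dist_comp Q A B B (Ar B) \<Phi> (b, a) \<preceq> \<Phi> (b, a)"
    by (rule dist_comp_least[OF \<Phi> B' ob h]) (rule distributor_left[OF \<Phi> a _ b])
  have "\<one>(Ty B b) \<cdot> \<Phi> (b, a) \<preceq> Ar B (b, b) \<cdot> \<Phi> (b, a)"
    by (rule comp_mono_left[OF qcategory_id[OF B b] Idn_Hom qcategory_hom[OF B b b] h]) (rule ob)
  then have "\<Phi> (b, a) \<preceq> Ar B (b, b) \<cdot> \<Phi> (b, a)"
    using Idn_left[OF h] by simp
  then show "\<Phi> (b, a) \<preceq> dist_comp Q A B B (Ar B) \<Phi> (b, a)"
    by (rule le_trans[OF _ dist_comp_upper[OF \<Phi> B' ob b] h Comp_Hom[OF h qcategory_hom[OF B b b]]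
          distributor_hom[OF d a b]])
qed

section \<open>Liftings of presheaves\<close>

lemma presheaf_iff:
  assumes "qcategory Q A"
  shows "distributor Q (star Q X) A \<phi> \<longleftrightarrow> (\<forall>a\<in>Ob A. \<phi> (a, ()) \<in> hom X (Ty A a)) \<and>
    \<phi> \<in> extensional (Ob A \<times> UNIV) \<and>
    (\<forall>a\<in>Ob A. \<forall>a'\<in>Ob A. Ar A (a', a) \<cdot> \<phi> (a, ()) \<preceq> \<phi> (a', ()))"
  unfolding distributor_def PiE_def Pi_def
  by (auto simp: UNIV_unit Idn_right le_refl)

text \<open>The supremum is the meet of the residuals \<open>[\<psi> i, \<phi> i]\<close>. It lies in the set
  itself because composition preserves suprema; in this form individual residuals never have to be
  formed.\<close>

lemma Sup_down_set:
  assumes "X \<in> Obj Q" "Y \<in> Obj Q" and "x \<in> hom X Y"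
    and \<psi>: "\<And>i. i \<in> I \<Longrightarrow> \<psi> i \<in> hom Y (T i)" and \<phi>: "\<And>i. i \<in> I \<Longrightarrow> \<phi> i \<in> hom X (T i)"
  shows "x \<preceq> \<Squnion>\<^bsub>Hom Q X Y\<^esub> {x \<in> hom X Y. \<forall>i\<in>I. \<psi> i \<cdot> x \<preceq> \<phi> i} \<longleftrightarrow> (\<forall>i\<in>I. \<psi> i \<cdot> x \<preceq> \<phi> i)"
    (is "x \<preceq> \<Squnion>\<^bsub>_\<^esub> ?S \<longleftrightarrow> _")
proof
  have S: "?S \<subseteq> hom X Y" by blast
  note h = Sup_hom[OF assms(1,2) S]
  assume le: "x \<preceq> \<Squnion>\<^bsub>Hom Q X Y\<^esub> ?S"
  show "\<forall>i\<in>I. \<psi> i \<cdot> x \<preceq> \<phi> i"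
  proof
    fix i assume i: "i \<in> I"
    have "\<psi> i \<cdot> \<Squnion>\<^bsub>Hom Q X Y\<^esub> ?S \<preceq> \<phi> i"
      by (rule comp_Sup_le[OF S \<psi>[OF i] \<phi>[OF i]]) (use i in blast)
    then show "\<psi> i \<cdot> x \<preceq> \<phi> i"
      by (rule le_trans[OF comp_mono_right[OF le assms(3) h \<psi>[OF i]] _ Comp_Hom[OF assms(3) \<psi>[OF i]]
            Comp_Hom[OF h \<psi>[OF i]] \<phi>[OF i]])
  qed
next
  assume "\<forall>i\<in>I. \<psi> i \<cdot> x \<preceq> \<phi> i"
  then show "x \<preceq> \<Squnion>\<^bsub>Hom Q X Y\<^esub> ?S"
    by (intro Sup_upper[OF assms(1,2)]) (use assms(3) in blast)+
qed

lemma dist_comp_star_left: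
  assumes "distributor Q (star Q X) (star Q Y) \<Xi>" "distributor Q (star Q Y) A \<psi>" "a \<in> Ob A" "X \<in> Obj Q" "Ty A a \<in> Obj Q"
  shows "dist_comp Q (star Q X) (star Q Y) A \<psi> \<Xi> (a, ()) = \<psi> (a, ()) \<cdot> \<Xi> ((), ())"
proof -
  have "\<psi> (a, ()) \<cdot> \<Xi> ((), ()) \<in> hom X (Ty A a)"
    using Comp_Hom distributor_hom[OF assms(1)] distributor_hom[OF assms(2)] assms(3) by simp
  then show ?thesis
    using Sup_pair[of "\<psi> (a, ()) \<cdot> \<Xi> ((), ())" "\<psi> (a, ()) \<cdot> \<Xi> ((), ())"] assms(3) le_refl
    by (simp add: dist_comp_def)
qed

lemma star_distributor:
  assumes "X \<in> Obj Q" "Y \<in> Obj Q"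
  shows "distributor Q (star Q X) (star Q Y) \<Xi> \<longleftrightarrow> \<Xi> ((), ()) \<in> hom X Y"
  unfolding presheaf_iff[OF star_qcategory[OF assms(2)]]
  by (auto simp: extensional_def Idn_left le_refl)

text \<open>A distributor between one-object categories is a single arrow, so the lifting is the largest arrow
  \<open>x\<close> that satisfies the defining inequality at each object of \<open>A\<close>.\<close>

lemma dist_lift_greatest_iff:
  assumes A: "qcategory Q A" and "X \<in> Obj Q" "Y \<in> Obj Q"
    and \<psi>: "distributor Q (star Q Y) A \<psi>" and \<phi>: "distributor Q (star Q X) A \<phi>"
  defines "h \<equiv> \<Squnion>\<^bsub>Hom Q X Y\<^esub> {x \<in> hom X Y. \<forall>a\<in>Ob A. \<psi> (a, ()) \<cdot> x \<preceq> \<phi> (a, ())}"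
  shows "greatest (Dist Q (star Q X) (star Q Y)) \<Xi>
    {\<Xi> \<in> carrier (Dist Q (star Q X) (star Q Y)).
       dist_comp Q (star Q X) (star Q Y) A \<psi> \<Xi> \<sqsubseteq>\<^bsub>Dist Q (star Q X) A\<^esub> \<phi>} \<longleftrightarrow> \<Xi> = (\<lambda>_. h)"
    (is "greatest ?D _ ?S \<longleftrightarrow> _")
proof -
  have homs: "\<psi> (a, ()) \<in> hom Y (Ty A a)" "\<phi> (a, ()) \<in> hom X (Ty A a)" if "a \<in> Ob A" for a
    using that distributor_hom[OF \<psi>] distributor_hom[OF \<phi>] by auto
  have h: "h \<in> hom X Y"
    unfolding h_def by (rule Sup_hom[OF assms(2,3)]) blast
  have le_h: "x \<preceq> h \<longleftrightarrow> (\<forall>a\<in>Ob A. \<psi> (a, ()) \<cdot> x \<preceq> \<phi> (a, ()))" if "x \<in> hom X Y" for x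
    unfolding h_def by (rule Sup_down_set[OF assms(2,3) that homs])
  have greatest_h: "greatest ?D (\<lambda>_. h) ?S"
    unfolding greatest_def
    using h le_refl[OF h] le_h[OF h] le_h
    by (auto simp: Lower_def star_distributor[OF assms(2,3)] Dist_def
         dist_comp_star_left[OF _ \<psi> _ assms(2) qcategory_Obj[OF A]])
  moreover have "\<Xi> = (\<lambda>_. h)" if "greatest ?D \<Xi> ?S"
    using that greatest_h
    unfolding greatest_def Lower_def
    by (intro distributor_eqI[of "star Q X" "star Q Y"]) (auto simp: star_distributor[OF assms(2,3)])
  ultimately show ?thesis by blast
qed

lemma dist_lift_eq:
  assumes "qcategory Q A" "X \<in> Obj Q" "Y \<in> Obj Q"
    and "distributor Q (star Q Y) A \<psi>" "distributor Q (star Q X) A \<phi>"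
  shows "dist_lift Q (star Q X) (star Q Y) A \<psi> \<phi> =
    (\<lambda>_. \<Squnion>\<^bsub>Hom Q X Y\<^esub> {x \<in> hom X Y. \<forall>a\<in>Ob A. \<psi> (a, ()) \<cdot> x \<preceq> \<phi> (a, ())})"
  by (simp only: dist_lift_def dist_lift_greatest_iff[OF assms] the_eq_trivial)

end

section \<open>Equivalences as adjunctions\<close>

text \<open>One half of an equivalence: \<open>F\<close> is functorial and \<open>G \<circ> F \<cong> 1\<close>. The maps
  are arbitrary off the objects, so that composites and closed formulas can be used directly.\<close>

definition pseudo_section ::
  "('o, 'm) quantaloid \<Rightarrow> ('o, 'm, 'a) qcat \<Rightarrow> ('o, 'm, 'b) qcat \<Rightarrow> ('a \<Rightarrow> 'b) \<Rightarrow> ('b \<Rightarrow> 'a) \<Rightarrow> bool" where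
  "pseudo_section Q C D F G \<longleftrightarrow>
     (\<forall>c\<in>Ob C. F c \<in> Ob D \<and> Ty D (F c) = Ty C c \<and>
        \<one>\<^bsub>Q\<^esub>(Ty C c) \<preceq>\<^bsub>Q\<^esub> Ar C (G (F c), c) \<and> \<one>\<^bsub>Q\<^esub>(Ty C c) \<preceq>\<^bsub>Q\<^esub> Ar C (c, G (F c))) \<and>
     (\<forall>c\<in>Ob C. \<forall>c'\<in>Ob C. Ar C (c', c) \<preceq>\<^bsub>Q\<^esub> Ar D (F c', F c))"

lemma qcat_equivalent_iff:
  "qcat_equivalent Q C D \<longleftrightarrow> (\<exists>F G. pseudo_section Q C D F G \<and> pseudo_section Q D C G F)"
proof
  assume "qcat_equivalent Q C D"
  then obtain F G where F: "qfunctor Q C D F" and G: "qfunctor Q D C G"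
    and iso: "qfunctor_iso Q C C (compose (Ob C) G F) (\<lambda>a\<in>Ob C. a)"
      "qfunctor_iso Q D D (compose (Ob D) F G) (\<lambda>b\<in>Ob D. b)"
    unfolding qcat_equivalent_def by blast
  have FG: "F c \<in> Ob D" "G d \<in> Ob C" if "c \<in> Ob C" "d \<in> Ob D" for c d
    using F G that by (auto simp: qfunctor_def)
  have "pseudo_section Q C D F G" "pseudo_section Q D C G F"
    using F G iso by (auto simp: pseudo_section_def qfunctor_def qfunctor_iso_def qfunctor_le_def compose_eq)
  then show "\<exists>F G. pseudo_section Q C D F G \<and> pseudo_section Q D C G F" by blast
next
  assume "\<exists>F G. pseudo_section Q C D F G \<and> pseudo_section Q D C G F"
  then obtain F G where FG: "pseudo_section Q C D F G" "pseudo_section Q D C G F" by blast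
  then have F: "F c \<in> Ob D" if "c \<in> Ob C" for c using that by (auto simp: pseudo_section_def)
  from FG have G: "G d \<in> Ob C" if "d \<in> Ob D" for d using that by (auto simp: pseudo_section_def)
  show "qcat_equivalent Q C D"
    unfolding qcat_equivalent_def
    by (intro exI[of _ "restrict F (Ob C)"] exI[of _ "restrict G (Ob D)"])
       (use FG F G in \<open>auto simp: pseudo_section_def qfunctor_def qfunctor_iso_def qfunctor_le_def compose_eq\<close>)
qed

context quantaloid
begin

text \<open>The usual argument that an equivalence is an adjunction: transport along the functor, then compose
  with a component of the unit or of the counit.\<close>

lemma pseudo_section_adjunction:
  assumes C: "qcategory Q C" and D: "qcategory Q D"
    and F: "pseudo_section Q C D F G" and G: "pseudo_section Q D C G F"
    and c: "c \<in> Ob C" and d: "d \<in> Ob D"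
  shows "Ar D (F c, d) = Ar C (c, G d)"
proof -
  have Fc: "F c \<in> Ob D" "Ty D (F c) = Ty C c" "\<one>(Ty C c) \<preceq> Ar C (c, G (F c))"
    using F c by (auto simp: pseudo_section_def)
  have Gd: "G d \<in> Ob C" "Ty C (G d) = Ty D d" "\<one>(Ty D d) \<preceq> Ar D (F (G d), d)"
    using G d by (auto simp: pseudo_section_def)
  have FGd: "F (G d) \<in> Ob D" "Ty D (F (G d)) = Ty D d"
    and GFc: "G (F c) \<in> Ob C" "Ty C (G (F c)) = Ty C c"
    using F G Fc Gd by (auto simp: pseudo_section_def)
  have h: "Ar D (F c, d) \<in> hom (Ty D d) (Ty C c)" "Ar C (c, G d) \<in> hom (Ty D d) (Ty C c)"
    "Ar C (G (F c), G d) \<in> hom (Ty D d) (Ty C c)" "Ar C (c, G (F c)) \<in> hom (Ty C c) (Ty C c)"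
    "Ar D (F c, F (G d)) \<in> hom (Ty D d) (Ty C c)" "Ar D (F (G d), d) \<in> hom (Ty D d) (Ty D d)"
    using qcategory_hom[OF D d Fc(1)] qcategory_hom[OF C Gd(1) c] qcategory_hom[OF C Gd(1) GFc(1)]
      qcategory_hom[OF C GFc(1) c] qcategory_hom[OF D FGd(1) Fc(1)] qcategory_hom[OF D d FGd(1)]
    by (simp_all add: Fc(2) Gd(2) FGd(2) GFc(2))
  note id_c = Idn_Hom[OF qcategory_Obj[OF C c]] and id_d = Idn_Hom[OF qcategory_Obj[OF D d]]
  show ?thesis
  proof (rule le_antisym[OF _ _ h(1,2)])
    have "\<one>(Ty C c) \<cdot> Ar D (F c, d) \<preceq> Ar C (c, G (F c)) \<cdot> Ar C (G (F c), G d)"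
      using G Fc(1) d by (intro comp_mono[OF Fc(3) _ h(1,3) id_c h(4)]) (auto simp: pseudo_section_def)
    then show "Ar D (F c, d) \<preceq> Ar C (c, G d)"
      using le_trans[OF _ qcategory_comp[OF C Gd(1) GFc(1) c] h(1) Comp_Hom[OF h(3,4)] h(2)]
      by (simp add: Idn_left[OF h(1)])
    have "Ar C (c, G d) \<cdot> \<one>(Ty D d) \<preceq> Ar D (F c, F (G d)) \<cdot> Ar D (F (G d), d)"
      using F Gd(1) c by (intro comp_mono[OF _ Gd(3) id_d h(6,2,5)]) (auto simp: pseudo_section_def)
    then show "Ar C (c, G d) \<preceq> Ar D (F c, d)"
      using le_trans[OF _ qcategory_comp[OF D d FGd(1) Fc(1)] h(2) Comp_Hom[OF h(6,5)] h(1)]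
      by (simp add: Idn_right[OF h(2)])
  qed
qed

end

section \<open>The category of presheaves and the Yoneda lemma\<close>

definition yoneda :: "('o, 'm, 'c) qcat \<Rightarrow> 'c \<Rightarrow> 'o \<times> ('c \<times> unit \<Rightarrow> 'm)" where
  "yoneda A a = (Ty A a, \<lambda>(a', u) \<in> Ob A \<times> UNIV. Ar A (a', a))"

lemma yoneda_simps [simp]:
  "fst (yoneda A a) = Ty A a" "a' \<in> Ob A \<Longrightarrow> snd (yoneda A a) (a', u) = Ar A (a', a)"
  by (simp_all add: yoneda_def)

context quantaloid
begin

lemma presheaves_simps [simp]:
  "Ob (presheaves Q A) = {(X, \<phi>). X \<in> Obj Q \<and> distributor Q (star Q X) A \<phi>}"
  "Ty (presheaves Q A) = fst"
  by (simp_all add: presheaves_def Let_def)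

lemma presheaf_hom:
  assumes "p \<in> Ob (presheaves Q A)" "a \<in> Ob A"
  shows "snd p (a, ()) \<in> hom (fst p) (Ty A a)"
  using distributor_hom[of "star Q (fst p)" A "snd p" "()" a] assms by auto

lemma presheaf_action:
  assumes "p \<in> Ob (presheaves Q A)" "a \<in> Ob A" "a' \<in> Ob A"
  shows "Ar A (a', a) \<cdot> snd p (a, ()) \<preceq> snd p (a', ())"
  using distributor_left[of "star Q (fst p)" A "snd p" "()" a a'] assms by auto

context
  fixes A :: "('o, 'm, 'c) qcat"
  assumes A: "qcategory Q A"
begin

lemma presheaf_Ar_eq:
  assumes "p \<in> Ob (presheaves Q A)" "q \<in> Ob (presheaves Q A)"
  shows "Ar (presheaves Q A) (p, q) = \<Squnion>\<^bsub>Hom Q (fst q) (fst p)\<^esub>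
    {x \<in> hom (fst q) (fst p). \<forall>a\<in>Ob A. snd p (a, ()) \<cdot> x \<preceq> snd q (a, ())}"
  using assms dist_lift_eq[OF A] by (auto simp: presheaves_def Let_def)

lemma presheaf_Ar_hom:
  assumes "p \<in> Ob (presheaves Q A)" "q \<in> Ob (presheaves Q A)"
  shows "Ar (presheaves Q A) (p, q) \<in> hom (fst q) (fst p)"
  unfolding presheaf_Ar_eq[OF assms] by (rule Sup_hom) (use assms in auto)

text \<open>The universal property of the hom-arrows of presheaves; everything else about them is derived from
  it.\<close>

lemma le_presheaf_Ar_iff:
  assumes "p \<in> Ob (presheaves Q A)" "q \<in> Ob (presheaves Q A)" "x \<in> hom (fst q) (fst p)"
  shows "x \<preceq> Ar (presheaves Q A) (p, q) \<longleftrightarrow> (\<forall>a\<in>Ob A. snd p (a, ()) \<cdot> x \<preceq> snd q (a, ()))"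
  unfolding presheaf_Ar_eq[OF assms(1,2)]
  by (rule Sup_down_set[OF hom_Obj[OF assms(3)] assms(3) presheaf_hom[OF assms(1)] presheaf_hom[OF assms(2)]])

lemma presheaf_eval:
  assumes "p \<in> Ob (presheaves Q A)" "q \<in> Ob (presheaves Q A)" "a \<in> Ob A"
  shows "snd p (a, ()) \<cdot> Ar (presheaves Q A) (p, q) \<preceq> snd q (a, ())"
  using le_presheaf_Ar_iff[OF assms(1,2) presheaf_Ar_hom[OF assms(1,2)]]
    le_refl[OF presheaf_Ar_hom[OF assms(1,2)]] assms(3) by blast

lemma id_le_presheaf_Ar_iff:
  assumes "p \<in> Ob (presheaves Q A)" "q \<in> Ob (presheaves Q A)" "fst p = fst q"
  shows "\<one>(fst p) \<preceq> Ar (presheaves Q A) (p, q) \<longleftrightarrow> (\<forall>a\<in>Ob A. snd p (a, ()) \<preceq> snd q (a, ()))"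
proof -
  have "\<one>(fst p) \<in> hom (fst q) (fst p)"
    using assms Idn_Hom by auto
  then show ?thesis
    using le_presheaf_Ar_iff[OF assms(1,2)] Idn_right[OF presheaf_hom[OF assms(1)]] by simp
qed

lemma presheaves_qcategory: "qcategory Q (presheaves Q A)"
  unfolding qcategory_def
proof (intro conjI ballI)
  show "Ty (presheaves Q A) \<in> Ob (presheaves Q A) \<rightarrow> Obj Q" by auto
  have "Ar (presheaves Q A) \<in> extensional (Ob (presheaves Q A) \<times> Ob (presheaves Q A))"
    by (simp add: presheaves_def Let_def)
  then show "Ar (presheaves Q A) \<in> (\<Pi>\<^sub>E (a', a)\<in>Ob (presheaves Q A) \<times> Ob (presheaves Q A).
      hom (Ty (presheaves Q A) a) (Ty (presheaves Q A) a'))"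
    using presheaf_Ar_hom by (auto simp: PiE_def Pi_def simp del: presheaves_simps(1))
next
  fix p q r assume p: "p \<in> Ob (presheaves Q A)" and q: "q \<in> Ob (presheaves Q A)" and r: "r \<in> Ob (presheaves Q A)"
  note h = presheaf_Ar_hom[OF q p] presheaf_Ar_hom[OF r q]
  have "snd r (a, ()) \<cdot> (Ar (presheaves Q A) (r, q) \<cdot> Ar (presheaves Q A) (q, p)) \<preceq> snd p (a, ())"
    if a: "a \<in> Ob A" for a
  proof -
    note k = presheaf_hom[OF p a] presheaf_hom[OF q a] presheaf_hom[OF r a]
    show ?thesis
      unfolding Comp_assoc[OF h k(3), symmetric]
      by (rule le_trans[OF comp_mono_left[OF presheaf_eval[OF r q a] _ k(2) h(1)] presheaf_eval[OF q p a]])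
         (rule Comp_Hom h k)+
  qed
  then show "Ar (presheaves Q A) (r, q) \<cdot> Ar (presheaves Q A) (q, p) \<preceq> Ar (presheaves Q A) (r, p)"
    using le_presheaf_Ar_iff[OF r p Comp_Hom[OF h]] by blast
next
  fix p assume p: "p \<in> Ob (presheaves Q A)"
  then show "\<one>(Ty (presheaves Q A) p) \<preceq> Ar (presheaves Q A) (p, p)"
    using id_le_presheaf_Ar_iff[OF p p] le_refl[OF presheaf_hom[OF p]] by simp
qed

text \<open>Because the hom-sets of a quantaloid are partially ordered, isomorphic presheaves are equal.\<close>

lemma presheaves_skeletal:
  assumes p: "p \<in> Ob (presheaves Q A)" and q: "q \<in> Ob (presheaves Q A)" and t: "fst p = fst q"
    and "\<one>(fst p) \<preceq> Ar (presheaves Q A) (p, q)" "\<one>(fst p) \<preceq> Ar (presheaves Q A) (q, p)"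
  shows "p = q"
proof (rule prod_eqI[OF t])
  show "snd p = snd q"
    by (rule distributor_eqI[of "star Q (fst p)" A])
       (use assms id_le_presheaf_Ar_iff[OF p q t] id_le_presheaf_Ar_iff[OF q p t[symmetric]] in auto)
qed

lemma yoneda_Ob: "a \<in> Ob A \<Longrightarrow> yoneda A a \<in> Ob (presheaves Q A)"
  using qcategory_Obj[OF A] qcategory_hom[OF A] qcategory_comp[OF A]
  by (auto simp: presheaf_iff[OF A] yoneda_def)

text \<open>The largest \<open>x\<close> with \<open>A(a', a) \<cdot> x \<le> p a'\<close> for all \<open>a'\<close> is \<open>p a\<close>: the action
  of \<open>A\<close> on \<open>p\<close> makes \<open>p a\<close> admissible, and \<open>1 \<le> A(a, a)\<close> bounds every
  admissible \<open>x\<close>.\<close>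

lemma yoneda_lemma:
  assumes a: "a \<in> Ob A" and p: "p \<in> Ob (presheaves Q A)"
  shows "Ar (presheaves Q A) (yoneda A a, p) = snd p (a, ())"
proof (rule le_antisym)
  note y = yoneda_Ob[OF a]
  have h: "Ar (presheaves Q A) (yoneda A a, p) \<in> hom (fst p) (Ty A a)"
    using presheaf_Ar_hom[OF y p] by simp
  show "Ar (presheaves Q A) (yoneda A a, p) \<in> hom (fst p) (Ty A a)" by (rule h)
  show k: "snd p (a, ()) \<in> hom (fst p) (Ty A a)" by (rule presheaf_hom[OF p a])
  show "snd p (a, ()) \<preceq> Ar (presheaves Q A) (yoneda A a, p)"
    using le_presheaf_Ar_iff[OF y p] k presheaf_action[OF p a] by simp
  have "\<one>(Ty A a) \<cdot> Ar (presheaves Q A) (yoneda A a, p) \<preceq> Ar A (a, a) \<cdot> Ar (presheaves Q A) (yoneda A a, p)"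
    by (rule comp_mono_left[OF qcategory_id[OF A a] Idn_Hom[OF qcategory_Obj[OF A a]] qcategory_hom[OF A a a] h])
  then show "Ar (presheaves Q A) (yoneda A a, p) \<preceq> snd p (a, ())"
    using le_trans[OF _ _ h Comp_Hom[OF h qcategory_hom[OF A a a]] k] presheaf_eval[OF y p a] a
    by (simp add: Idn_left[OF h])
qed

lemma yoneda_fully_faithful:
  "a \<in> Ob A \<Longrightarrow> a' \<in> Ob A \<Longrightarrow> Ar (presheaves Q A) (yoneda A a', yoneda A a) = Ar A (a', a)"
  using yoneda_lemma[OF _ yoneda_Ob] by simp

end

lemma full_subcategory_simps [simp]:
  "Ob (full_subcategory C S) = S" "Ty (full_subcategory C S) = Ty C"
  "x \<in> S \<Longrightarrow> y \<in> S \<Longrightarrow> Ar (full_subcategory C S) (x, y) = Ar C (x, y)"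
  by (simp_all add: full_subcategory_def)

lemma full_subcategory_qcategory:
  assumes C: "qcategory Q C" and S: "S \<subseteq> Ob C"
  shows "qcategory Q (full_subcategory C S)"
  using qcategory_Obj[OF C] qcategory_hom[OF C] qcategory_comp[OF C] qcategory_id[OF C] S
  by (auto simp: qcategory_def full_subcategory_def subset_iff)

lemma full_subcategory_Ob:
  assumes "qcategory Q C"
  shows "full_subcategory C (Ob C) = C"
  using assms
  by (auto simp: qcategory_def full_subcategory_def PiE_def extensional_restrict)

end

section \<open>The action of distributors on presheaves\<close>

text \<open>The presheaf \<open>\<Phi> \<otimes> p\<close>, the left Kan extension of \<open>p\<close> along \<open>\<Phi>\<close>.\<close>

definition pushforward ::
  "('o, 'm) quantaloid \<Rightarrow> ('o, 'm, 'a) qcat \<Rightarrow> ('o, 'm, 'b) qcat \<Rightarrow> ('b \<times> 'a \<Rightarrow> 'm)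
     \<Rightarrow> 'o \<times> ('a \<times> unit \<Rightarrow> 'm) \<Rightarrow> 'o \<times> ('b \<times> unit \<Rightarrow> 'm)" where
  "pushforward Q A B \<Phi> p = (fst p, dist_comp Q (star Q (fst p)) A B \<Phi> (snd p))"

lemma fst_pushforward [simp]: "fst (pushforward Q A B \<Phi> p) = fst p"
  by (simp add: pushforward_def)

context quantaloid
begin

lemma pushforward_Ob:
  assumes B: "qcategory Q B" and \<Phi>: "distributor Q A B \<Phi>"
    and p: "p \<in> Ob (presheaves Q A)"
  shows "pushforward Q A B \<Phi> p \<in> Ob (presheaves Q B)"
  using p dist_comp_distributor[OF star_qcategory B _ \<Phi>] by (auto simp: pushforward_def)

lemma pushforward_upper:
  assumes B: "qcategory Q B" and \<Phi>: "distributor Q A B \<Phi>"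
    and p: "p \<in> Ob (presheaves Q A)" and a: "a \<in> Ob A" and b: "b \<in> Ob B"
  shows "\<Phi> (b, a) \<cdot> snd p (a, ()) \<preceq> snd (pushforward Q A B \<Phi> p) (b, ())"
  using dist_comp_upper[of "star Q (fst p)" A "snd p" B \<Phi> "()" b a] p \<Phi> a b qcategory_Obj[OF B b]
  by (auto simp: pushforward_def)

lemma pushforward_comp_le:
  assumes B: "qcategory Q B" and \<Phi>: "distributor Q A B \<Phi>"
    and p: "p \<in> Ob (presheaves Q A)" and b: "b \<in> Ob B"
    and f: "f \<in> hom X (fst p)" and h: "h \<in> hom X (Ty B b)"
    and le: "\<And>a. a \<in> Ob A \<Longrightarrow> \<Phi> (b, a) \<cdot> (snd p (a, ()) \<cdot> f) \<preceq> h"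
  shows "snd (pushforward Q A B \<Phi> p) (b, ()) \<cdot> f \<preceq> h"
  using dist_comp_le_right[of "star Q (fst p)" A "snd p" B \<Phi> "()" b f X h] p \<Phi> b qcategory_Obj[OF B b] f h le
  by (auto simp: pushforward_def)

text \<open>If \<open>p a \<cdot> h \<le> q a\<close> for all \<open>a\<close>, composing with \<open>\<Phi>(b, a)\<close> and joining over
  \<open>a\<close> gives \<open>(\<Phi> \<otimes> p) b \<cdot> h \<le> (\<Phi> \<otimes> q) b\<close>.\<close>

lemma pushforward_mono:
  assumes A: "qcategory Q A" and B: "qcategory Q B" and \<Phi>: "distributor Q A B \<Phi>"
    and p: "p \<in> Ob (presheaves Q A)" and q: "q \<in> Ob (presheaves Q A)"
  shows "Ar (presheaves Q A) (p, q) \<preceq> Ar (presheaves Q B) (pushforward Q A B \<Phi> p, pushforward Q A B \<Phi> q)"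
proof -
  let ?h = "Ar (presheaves Q A) (p, q)"
  note h = presheaf_Ar_hom[OF A p q]
  note Ep = pushforward_Ob[OF B \<Phi> p] and Eq = pushforward_Ob[OF B \<Phi> q]
  have "snd (pushforward Q A B \<Phi> p) (b, ()) \<cdot> ?h \<preceq> snd (pushforward Q A B \<Phi> q) (b, ())" if b: "b \<in> Ob B" for b
  proof (rule pushforward_comp_le[OF B \<Phi> p b h])
    show E: "snd (pushforward Q A B \<Phi> q) (b, ()) \<in> hom (fst q) (Ty B b)"
      using presheaf_hom[OF Eq b] by simp
    fix a assume a: "a \<in> Ob A"
    note homs = distributor_hom[OF \<Phi> a b] presheaf_hom[OF p a] presheaf_hom[OF q a] h E
    show "\<Phi> (b, a) \<cdot> (snd p (a, ()) \<cdot> ?h) \<preceq> snd (pushforward Q A B \<Phi> q) (b, ())"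
      by (rule le_trans[OF comp_mono_right[OF presheaf_eval[OF A p q a]] pushforward_upper[OF B \<Phi> q a b]])
        (rule Comp_Hom homs)+
  qed
  then show ?thesis
    using le_presheaf_Ar_iff[OF B Ep Eq] h by simp
qed

lemma pushforward_pushforward:
  assumes "qcategory Q A" "qcategory Q B" "qcategory Q C"
    and "distributor Q A B \<Phi>" "distributor Q B C \<Psi>" "p \<in> Ob (presheaves Q A)"
  shows "pushforward Q B C \<Psi> (pushforward Q A B \<Phi> p) = pushforward Q A C (dist_comp Q A B C \<Psi> \<Phi>) p"
  using dist_comp_assoc[OF star_qcategory assms(1-3) _ assms(4,5)] assms(6)
  by (auto simp: pushforward_def)

lemma pushforward_Ar:
  assumes "qcategory Q A" "p \<in> Ob (presheaves Q A)"
  shows "pushforward Q A A (Ar A) p = p"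
  using dist_comp_Ar_left[OF star_qcategory assms(1)] assms(2) by (auto simp: pushforward_def)

text \<open>Functoriality of \<open>\<Phi> \<mapsto> \<Phi> \<otimes> _\<close> turns a left inverse of \<open>\<Phi>\<close> into a left inverse,
  on the nose, of the functor. The sets \<open>S\<close> and \<open>T\<close> cover presheaf categories and Cauchy
  completions at once.\<close>

lemma pushforward_pseudo_section:
  assumes A: "qcategory Q A" and B: "qcategory Q B"
    and \<Phi>: "distributor Q A B \<Phi>" and \<Psi>: "distributor Q B A \<Psi>"
    and inv: "dist_comp Q A B A \<Psi> \<Phi> = Ar A"
    and S: "S \<subseteq> Ob (presheaves Q A)" and ST: "pushforward Q A B \<Phi> ` S \<subseteq> T"
  shows "pseudo_section Q (full_subcategory (presheaves Q A) S) (full_subcategory (presheaves Q B) T)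
    (pushforward Q A B \<Phi>) (pushforward Q B A \<Psi>)"
proof -
  have "pushforward Q B A \<Psi> (pushforward Q A B \<Phi> p) = p" if "p \<in> S" for p
    using pushforward_pushforward[OF A B A \<Phi> \<Psi>] pushforward_Ar[OF A] inv S that by force
  moreover have "\<one>(fst p) \<preceq> Ar (presheaves Q A) (p, p)" if "p \<in> S" for p
    using qcategory_id[OF presheaves_qcategory[OF A]] S that by fastforce
  moreover have "Ar (presheaves Q A) (p, q) \<preceq> Ar (presheaves Q B) (pushforward Q A B \<Phi> p, pushforward Q A B \<Phi> q)"
    if "p \<in> S" "q \<in> S" for p q
    using pushforward_mono[OF A B \<Phi>] S that by blast
  ultimately show ?thesis
    using ST by (auto simp: pseudo_section_def full_subcategory_def)
qed

text \<open>The unit is \<open>A \<le> \<Psi> \<otimes> \<Phi> \<le> \<Psi> \<otimes> (\<Delta> \<otimes> \<Gamma>) \<otimes> \<Phi>\<close>, the unit of the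
  second adjunction being inserted in the middle; the counit is obtained dually.\<close>

lemma dist_adjoint_comp:
  assumes A: "qcategory Q A" and B: "qcategory Q B" and C: "qcategory Q C"
    and adj1: "dist_adjoint Q A B \<Phi> \<Psi>" and adj2: "dist_adjoint Q B C \<Gamma> \<Delta>"
  shows "dist_adjoint Q A C (dist_comp Q A B C \<Gamma> \<Phi>) (dist_comp Q C B A \<Psi> \<Delta>)"
proof -
  have d: "distributor Q A B \<Phi>" "distributor Q B A \<Psi>" "distributor Q B C \<Gamma>" "distributor Q C B \<Delta>"
    using adj1 adj2 by (simp_all add: dist_adjoint_def)
  note \<Gamma>\<Phi> = dist_comp_distributor[OF A C d(1,3)] and \<Psi>\<Delta> = dist_comp_distributor[OF C A d(4,2)]
    and \<Psi>\<Phi> = dist_comp_distributor[OF A A d(1,2)] and \<Phi>\<Psi> = dist_comp_distributor[OF B B d(2,1)]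
    and \<Delta>\<Gamma> = dist_comp_distributor[OF B B d(3,4)] and \<Gamma>\<Delta> = dist_comp_distributor[OF C C d(4,3)]
  note \<Delta>\<Gamma>\<Phi> = dist_comp_distributor[OF A B d(1) \<Delta>\<Gamma>] and \<Phi>\<Psi>\<Delta> = dist_comp_distributor[OF C B d(4) \<Phi>\<Psi>]
  note BB = qcategory_distributor[OF B]
  have unit: "Ar A (a', a) \<preceq> dist_comp Q A C A (dist_comp Q C B A \<Psi> \<Delta>) (dist_comp Q A B C \<Gamma> \<Phi>) (a', a)"
    if a: "a \<in> Ob A" and a': "a' \<in> Ob A" for a a'
  proof -
    note ob = a a' qcategory_Obj[OF A a] qcategory_Obj[OF A a']
    have "dist_comp Q A C A (dist_comp Q C B A \<Psi> \<Delta>) (dist_comp Q A B C \<Gamma> \<Phi>)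
        = dist_comp Q A B A \<Psi> (dist_comp Q A B B (dist_comp Q B C B \<Delta> \<Gamma>) \<Phi>)"
      using dist_comp_assoc[OF A C B A \<Gamma>\<Phi> d(4,2)] dist_comp_assoc[OF A B C B d(1,3,4)] by simp
    moreover have "dist_comp Q A B A \<Psi> (dist_comp Q A B B (Ar B) \<Phi>) (a', a) \<preceq>
        dist_comp Q A B A \<Psi> (dist_comp Q A B B (dist_comp Q B C B \<Delta> \<Gamma>) \<Phi>) (a', a)"
      using a adj2 le_refl[OF distributor_hom[OF d(2) _ a']] le_refl[OF distributor_hom[OF d(1) a]]
        qcategory_Obj[OF A a] qcategory_Obj[OF B]
      by (intro dist_comp_mono[OF dist_comp_distributor[OF A B d(1) BB] \<Delta>\<Gamma>\<Phi> d(2,2) ob]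
          dist_comp_mono[OF d(1,1) BB \<Delta>\<Gamma>]) (auto simp: dist_adjoint_def)
    moreover have "Ar A (a', a) \<preceq> dist_comp Q A B A \<Psi> \<Phi> (a', a)"
      using adj1 a a' by (simp add: dist_adjoint_def)
    ultimately show ?thesis
      using le_trans[OF _ _ qcategory_hom[OF A a a'] distributor_hom[OF \<Psi>\<Phi> a a']
          distributor_hom[OF dist_comp_distributor[OF A A \<Gamma>\<Phi> \<Psi>\<Delta>] a a']]
      by (simp add: dist_comp_Ar_left[OF A B d(1)])
  qed
  have counit: "dist_comp Q C A C (dist_comp Q A B C \<Gamma> \<Phi>) (dist_comp Q C B A \<Psi> \<Delta>) (c', c) \<preceq> Ar C (c', c)"
    if c: "c \<in> Ob C" and c': "c' \<in> Ob C" for c c'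
  proof -
    note ob = c c' qcategory_Obj[OF C c] qcategory_Obj[OF C c']
    have "dist_comp Q C A C (dist_comp Q A B C \<Gamma> \<Phi>) (dist_comp Q C B A \<Psi> \<Delta>)
        = dist_comp Q C B C \<Gamma> (dist_comp Q C B B (dist_comp Q B A B \<Phi> \<Psi>) \<Delta>)"
      using dist_comp_assoc[OF C A B C \<Psi>\<Delta> d(1,3)] dist_comp_assoc[OF C B A B d(4,2,1)] by simp
    moreover have "dist_comp Q C B C \<Gamma> (dist_comp Q C B B (dist_comp Q B A B \<Phi> \<Psi>) \<Delta>) (c', c) \<preceq>
        dist_comp Q C B C \<Gamma> (dist_comp Q C B B (Ar B) \<Delta>) (c', c)"
      using c adj1 le_refl[OF distributor_hom[OF d(3) _ c']] le_refl[OF distributor_hom[OF d(4) c]]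
        qcategory_Obj[OF C c] qcategory_Obj[OF B]
      by (intro dist_comp_mono[OF \<Phi>\<Psi>\<Delta> dist_comp_distributor[OF C B d(4) BB] d(3,3) ob]
          dist_comp_mono[OF d(4,4) \<Phi>\<Psi> BB]) (auto simp: dist_adjoint_def)
    moreover have "dist_comp Q C B C \<Gamma> \<Delta> (c', c) \<preceq> Ar C (c', c)"
      using adj2 c c' by (simp add: dist_adjoint_def)
    ultimately show ?thesis
      using le_trans[OF _ _ distributor_hom[OF dist_comp_distributor[OF C C \<Psi>\<Delta> \<Gamma>\<Phi>] c c']
          distributor_hom[OF \<Gamma>\<Delta> c c'] qcategory_hom[OF C c c']]
      by (simp add: dist_comp_Ar_left[OF C B d(4)])
  qed
  show ?thesis
    using \<Gamma>\<Phi> \<Psi>\<Delta> unit counit by (simp add: dist_adjoint_def)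
qed

end

section \<open>Cauchy presheaves\<close>

definition cauchy_presheaves :: "('o, 'm) quantaloid \<Rightarrow> ('o, 'm, 'a) qcat \<Rightarrow> ('o \<times> ('a \<times> unit \<Rightarrow> 'm)) set" where
  "cauchy_presheaves Q A =
     {p \<in> Ob (presheaves Q A). \<exists>\<rho>. dist_adjoint Q (star Q (fst p)) A (snd p) \<rho>}"

lemma cauchy_presheaves_Ob: "cauchy_presheaves Q A \<subseteq> Ob (presheaves Q A)"
  by (simp add: cauchy_presheaves_def)

lemma cauchy_completion_eq:
  "cauchy_completion Q A = full_subcategory (presheaves Q A) (cauchy_presheaves Q A)"
  unfolding cauchy_completion_def cauchy_presheaves_def
  by (rule arg_cong[where f = "full_subcategory _"]) auto

context quantaloid
begin

lemma pushforward_cauchy: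
  assumes "qcategory Q A" "qcategory Q B" "dist_adjoint Q A B \<Phi> \<Psi>" "p \<in> cauchy_presheaves Q A"
  shows "pushforward Q A B \<Phi> p \<in> cauchy_presheaves Q B"
proof -
  obtain \<rho> where p: "p \<in> Ob (presheaves Q A)" and \<rho>: "dist_adjoint Q (star Q (fst p)) A (snd p) \<rho>"
    using assms(4) by (auto simp: cauchy_presheaves_def)
  have "fst p \<in> Obj Q" using p by auto
  from dist_adjoint_comp[OF star_qcategory[OF this] assms(1,2) \<rho> assms(3)] pushforward_Ob[OF assms(2) _ p] assms(3)
  show ?thesis
    by (auto simp: cauchy_presheaves_def pushforward_def dist_adjoint_def)
qed

text \<open>The right adjoint of the representable \<open>A(_, a)\<close> is \<open>A(a, _)\<close>; the unit holds already
  at the summand for \<open>a\<close>.\<close>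

lemma yoneda_cauchy:
  assumes A: "qcategory Q A" and a: "a \<in> Ob A"
  shows "yoneda A a \<in> cauchy_presheaves Q A"
proof -
  note X = qcategory_Obj[OF A a]
  let ?\<phi> = "snd (yoneda A a)" and ?\<rho> = "\<lambda>(u :: unit, a') \<in> UNIV \<times> Ob A. Ar A (a, a')"
  have \<phi>: "distributor Q (star Q (Ty A a)) A ?\<phi>"
    using yoneda_Ob[OF A a] by (auto simp: yoneda_def)
  have \<rho>: "distributor Q A (star Q (Ty A a)) ?\<rho>"
    using qcategory_hom[OF A _ a] qcategory_comp[OF A _ _ a] X
    by (intro distributorI) (auto simp: UNIV_unit Idn_left[OF qcategory_hom[OF A _ a]] le_refl[OF qcategory_hom[OF A _ a]])
  have "\<one>(Ty A a) \<preceq> dist_comp Q (star Q (Ty A a)) A (star Q (Ty A a)) ?\<rho> ?\<phi> ((), ())"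
  proof -
    note h = qcategory_hom[OF A a a] and i = Idn_Hom[OF X]
    have "\<one>(Ty A a) \<cdot> \<one>(Ty A a) \<preceq> Ar A (a, a) \<cdot> Ar A (a, a)"
      by (rule comp_mono[OF qcategory_id[OF A a] qcategory_id[OF A a] i h i h])
    moreover have "Ar A (a, a) \<cdot> Ar A (a, a) \<preceq> dist_comp Q (star Q (Ty A a)) A (star Q (Ty A a)) ?\<rho> ?\<phi> ((), ())"
      using dist_comp_upper[OF \<phi> \<rho>, of "()" "()" a] X a by simp
    ultimately show ?thesis
      using le_trans[OF _ _ i Comp_Hom[OF h h] dist_comp_hom[OF \<phi> \<rho>, of "()" "()", simplified, OF X]]
      by (simp add: Idn_left[OF i])
  qed
  moreover have "dist_comp Q A (star Q (Ty A a)) A ?\<phi> ?\<rho> (a'', a') \<preceq> Ar A (a'', a')"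
    if "a' \<in> Ob A" "a'' \<in> Ob A" for a' a''
    using that qcategory_Obj[OF A] qcategory_hom[OF A] qcategory_comp[OF A that(1) a that(2)]
    by (intro dist_comp_least[OF \<rho> \<phi>]) auto
  ultimately have "dist_adjoint Q (star Q (Ty A a)) A ?\<phi> ?\<rho>"
    using \<phi> \<rho> by (simp add: dist_adjoint_def)
  then show ?thesis
    using yoneda_Ob[OF A a] unfolding cauchy_presheaves_def by auto
qed

text \<open>Let \<open>\<rho>\<close> be right adjoint to \<open>p\<close> and \<open>h = P B (p, q)\<close>. The unit gives
  \<open>h \<le> \<Squnion> b. \<rho> b \<cdot> p b \<cdot> h\<close>, and \<open>p b \<cdot> h \<le> q b\<close>. The counit says
  \<open>p b' \<cdot> \<rho> b \<le> B(b', b)\<close>, that is, \<open>\<rho> b \<le> P B (p, y b)\<close>.\<close>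

lemma cauchy_density:
  assumes B: "qcategory Q B" and p: "p \<in> cauchy_presheaves Q B" and q: "q \<in> Ob (presheaves Q B)"
    and d: "d \<in> hom (fst q) (fst p)"
    and le: "\<And>b. b \<in> Ob B \<Longrightarrow> Ar (presheaves Q B) (p, yoneda B b) \<cdot> snd q (b, ()) \<preceq> d"
  shows "Ar (presheaves Q B) (p, q) \<preceq> d"
proof -
  let ?X = "fst p" and ?h = "Ar (presheaves Q B) (p, q)"
  obtain \<rho> where P: "p \<in> Ob (presheaves Q B)" and adj: "dist_adjoint Q (star Q ?X) B (snd p) \<rho>"
    using p by (auto simp: cauchy_presheaves_def)
  then have X: "?X \<in> Obj Q" and \<phi>: "distributor Q (star Q ?X) B (snd p)" and \<rho>: "distributor Q B (star Q ?X) \<rho>"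
    and unit: "\<one>?X \<preceq> dist_comp Q (star Q ?X) B (star Q ?X) \<rho> (snd p) ((), ())"
    by (auto simp: dist_adjoint_def)
  note h = presheaf_Ar_hom[OF B P q]
  have \<rho>_hom: "\<rho> ((), b) \<in> hom (Ty B b) ?X" if "b \<in> Ob B" for b
    using distributor_hom[OF \<rho> that] by simp
  have comp_hom: "dist_comp Q (star Q ?X) B (star Q ?X) \<rho> (snd p) ((), ()) \<in> hom ?X ?X"
    using dist_comp_hom[OF \<phi> \<rho>, of "()" "()"] X by simp
  have \<rho>_le: "\<rho> ((), b) \<preceq> Ar (presheaves Q B) (p, yoneda B b)" if b: "b \<in> Ob B" for b
  proof -
    have "snd p (b', ()) \<cdot> \<rho> ((), b) \<preceq> Ar B (b', b)" if b': "b' \<in> Ob B" for b'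
    proof (rule le_trans)
      show "snd p (b', ()) \<cdot> \<rho> ((), b) \<preceq> dist_comp Q B (star Q ?X) B (snd p) \<rho> (b', b)"
        using dist_comp_upper[OF \<rho> \<phi> b b' qcategory_Obj[OF B b] qcategory_Obj[OF B b']] by simp
      show "dist_comp Q B (star Q ?X) B (snd p) \<rho> (b', b) \<preceq> Ar B (b', b)"
        using adj b b' by (simp add: dist_adjoint_def)
      show "snd p (b', ()) \<cdot> \<rho> ((), b) \<in> hom (Ty B b) (Ty B b')"
        by (rule Comp_Hom[OF \<rho>_hom[OF b] presheaf_hom[OF P b']])
      show "dist_comp Q B (star Q ?X) B (snd p) \<rho> (b', b) \<in> hom (Ty B b) (Ty B b')"
        by (rule dist_comp_hom[OF \<rho> \<phi> b b' qcategory_Obj[OF B b] qcategory_Obj[OF B b']])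
      show "Ar B (b', b) \<in> hom (Ty B b) (Ty B b')"
        by (rule qcategory_hom[OF B b b'])
    qed
    then show ?thesis
      using le_presheaf_Ar_iff[OF B P yoneda_Ob[OF B b]] \<rho>_hom[OF b] by simp
  qed
  have "\<one>?X \<cdot> ?h \<preceq> dist_comp Q (star Q ?X) B (star Q ?X) \<rho> (snd p) ((), ()) \<cdot> ?h"
    by (rule comp_mono_left[OF unit Idn_Hom[OF X] comp_hom h])
  moreover have "dist_comp Q (star Q ?X) B (star Q ?X) \<rho> (snd p) ((), ()) \<cdot> ?h \<preceq> d"
  proof (rule dist_comp_le_right[OF \<phi> \<rho>])
    fix b assume b: "b \<in> Ob B"
    have k: "Ar (presheaves Q B) (p, yoneda B b) \<in> hom (Ty B b) ?X"
      using presheaf_Ar_hom[OF B P yoneda_Ob[OF B b]] by simp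
    note homs = \<rho>_hom[OF b] presheaf_hom[OF P b] presheaf_hom[OF q b] h k d
    show "\<rho> ((), b) \<cdot> (snd p (b, ()) \<cdot> ?h) \<preceq> d"
      by (rule le_trans[OF comp_mono[OF \<rho>_le[OF b] presheaf_eval[OF B P q b]] le[OF b]])
        (rule Comp_Hom homs)+
  qed (use X d h in auto)
  ultimately show ?thesis
    using le_trans[OF _ _ h Comp_Hom[OF h comp_hom] d] by (simp add: Idn_left[OF h])
qed

end

section \<open>From equivalences of presheaf categories to distributors\<close>

definition distributor_of ::
  "('o, 'm, 'a) qcat \<Rightarrow> ('o, 'm, 'b) qcat \<Rightarrow> ('a \<Rightarrow> 'o \<times> ('b \<times> unit \<Rightarrow> 'm)) \<Rightarrow> ('b \<times> 'a \<Rightarrow> 'm)" where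
  "distributor_of A B K = (\<lambda>(b, a) \<in> Ob B \<times> Ob A. snd (K a) (b, ()))"

text \<open>The action of \<open>B\<close> comes from each \<open>K a\<close> being a presheaf, the action of \<open>A\<close> from
  functoriality of \<open>K\<close>.\<close>

lemma (in quantaloid) distributor_of_distributor:
  assumes A: "qcategory Q A" and B: "qcategory Q B"
    and K: "\<And>a. a \<in> Ob A \<Longrightarrow> K a \<in> Ob (presheaves Q B)" "\<And>a. a \<in> Ob A \<Longrightarrow> fst (K a) = Ty A a"
    and mono: "\<And>a a'. a \<in> Ob A \<Longrightarrow> a' \<in> Ob A \<Longrightarrow> Ar A (a', a) \<preceq> Ar (presheaves Q B) (K a', K a)"
  shows "distributor Q A B (distributor_of A B K)"
proof (rule distributorI)
  show "distributor_of A B K \<in> extensional (Ob B \<times> Ob A)"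
    by (simp add: distributor_of_def)
  have hom: "snd (K a) (b, ()) \<in> hom (Ty A a) (Ty B b)" if "a \<in> Ob A" "b \<in> Ob B" for a b
    using presheaf_hom[OF K(1) that(2)] K(2) that(1) by metis
  then show "distributor_of A B K (b, a) \<in> hom (Ty A a) (Ty B b)" if "a \<in> Ob A" "b \<in> Ob B" for a b
    using that by (simp add: distributor_of_def)
  show "Ar B (b', b) \<cdot> distributor_of A B K (b, a) \<preceq> distributor_of A B K (b', a)"
    if "a \<in> Ob A" "b \<in> Ob B" "b' \<in> Ob B" for a b b'
    using presheaf_action[OF K(1)] that by (simp add: distributor_of_def)
  show "distributor_of A B K (b, a) \<cdot> Ar A (a, a') \<preceq> distributor_of A B K (b, a')"
    if a: "a \<in> Ob A" and a': "a' \<in> Ob A" and b: "b \<in> Ob B" for a a' b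
  proof -
    have "Ar A (a, a') \<in> hom (fst (K a')) (fst (K a))"
      using qcategory_hom[OF A a' a] K(2) a a' by simp
    then show ?thesis
      using le_presheaf_Ar_iff[OF B K(1)[OF a] K(1)[OF a']] mono[OF a' a] a a' b
      by (simp add: distributor_of_def)
  qed
qed

text \<open>An equivalence between full subcategories \<open>S\<close> and \<open>T\<close> of presheaf categories that
  contain the representables: all presheaves give the case of presheaf categories, Cauchy presheaves give that of Cauchy completions.
  The hypotheses are symmetric, so that each result about \<open>F\<close> also holds for \<open>G\<close>, by
  \<open>flip\<close>.\<close>

locale presheaf_equivalence = quantaloid Q
  for Q :: "('o, 'm) quantaloid" (structure) +
  fixes A :: "('o, 'm, 'a) qcat" and B :: "('o, 'm, 'b) qcat"
    and S T F G
  assumes A: "qcategory Q A" and B: "qcategory Q B"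
    and S: "S \<subseteq> Ob (presheaves Q A)" and T: "T \<subseteq> Ob (presheaves Q B)"
    and yoneda_S: "yoneda A ` Ob A \<subseteq> S" and yoneda_T: "yoneda B ` Ob B \<subseteq> T"
    and F: "pseudo_section Q (full_subcategory (presheaves Q A) S) (full_subcategory (presheaves Q B) T) F G"
    and G: "pseudo_section Q (full_subcategory (presheaves Q B) T) (full_subcategory (presheaves Q A) S) G F"
begin

lemma flip: "presheaf_equivalence Q B A T S G F"
  using A B S T yoneda_S yoneda_T F G by unfold_locales

abbreviation PA where "PA \<equiv> Ar (presheaves Q A)"
abbreviation PB where "PB \<equiv> Ar (presheaves Q B)"

lemma S_Ob: "p \<in> S \<Longrightarrow> p \<in> Ob (presheaves Q A)" and T_Ob: "q \<in> T \<Longrightarrow> q \<in> Ob (presheaves Q B)"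
  using S T by blast+

lemma y_S: "a \<in> Ob A \<Longrightarrow> yoneda A a \<in> S" and y_T: "b \<in> Ob B \<Longrightarrow> yoneda B b \<in> T"
  using yoneda_S yoneda_T by blast+

lemma F_T: "p \<in> S \<Longrightarrow> F p \<in> T" and G_S: "q \<in> T \<Longrightarrow> G q \<in> S"
  and fst_F: "p \<in> S \<Longrightarrow> fst (F p) = fst p"
  using F G unfolding pseudo_section_def full_subcategory_simps(1,2) presheaves_simps(2) by blast+

lemma F_mono:
  assumes "p \<in> S" "p' \<in> S"
  shows "PA (p', p) \<preceq> PB (F p', F p)"
proof -
  have "Ar (full_subcategory (presheaves Q A) S) (p', p) \<preceq> Ar (full_subcategory (presheaves Q B) T) (F p', F p)"
    using F assms unfolding pseudo_section_def full_subcategory_simps(1) by blast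
  then show ?thesis using assms F_T by simp
qed

lemma adjunction:
  assumes "p \<in> S" "q \<in> T"
  shows "PB (F p, q) = PA (p, G q)"
  using pseudo_section_adjunction[OF full_subcategory_qcategory[OF presheaves_qcategory[OF A] S]
      full_subcategory_qcategory[OF presheaves_qcategory[OF B] T] F G, of p q] assms F_T G_S
  by simp

lemma G_F:
  assumes "p \<in> S"
  shows "G (F p) = p"
proof (rule presheaves_skeletal[OF A])
  show "G (F p) \<in> Ob (presheaves Q A)" "p \<in> Ob (presheaves Q A)"
    using assms F_T G_S S_Ob by blast+
  show t: "fst (G (F p)) = fst p"
    using presheaf_equivalence.fst_F[OF flip F_T[OF assms]] fst_F[OF assms] by simp
  show "\<one>(fst (G (F p))) \<preceq> PA (G (F p), p)" "\<one>(fst (G (F p))) \<preceq> PA (p, G (F p))"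
    using bspec[OF conjunct1[OF F[unfolded pseudo_section_def]], of p] assms G_S[OF F_T[OF assms]]
    unfolding t by simp_all
qed

definition \<Phi> where "\<Phi> = distributor_of A B (\<lambda>a. F (yoneda A a))"
definition \<Psi> where "\<Psi> = distributor_of B A (\<lambda>b. G (yoneda B b))"

lemma \<Phi>_apply: "a \<in> Ob A \<Longrightarrow> b \<in> Ob B \<Longrightarrow> \<Phi> (b, a) = snd (F (yoneda A a)) (b, ())"
  and \<Psi>_apply: "a \<in> Ob A \<Longrightarrow> b \<in> Ob B \<Longrightarrow> \<Psi> (a, b) = snd (G (yoneda B b)) (a, ())"
  by (simp_all add: \<Phi>_def \<Psi>_def distributor_of_def)

lemma \<Phi>_distributor: "distributor Q A B \<Phi>"
  unfolding \<Phi>_def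
proof (rule distributor_of_distributor[OF A B])
  fix a assume a: "a \<in> Ob A"
  show "F (yoneda A a) \<in> Ob (presheaves Q B)" by (rule T_Ob[OF F_T[OF y_S[OF a]]])
  show "fst (F (yoneda A a)) = Ty A a" by (simp add: fst_F[OF y_S[OF a]])
  fix a' assume a': "a' \<in> Ob A"
  show "Ar A (a', a) \<preceq> PB (F (yoneda A a'), F (yoneda A a))"
    using F_mono[OF y_S[OF a] y_S[OF a']] by (simp add: yoneda_fully_faithful[OF A a a'])
qed

lemma \<Psi>_eq: "\<Psi> = presheaf_equivalence.\<Phi> B A G"
  by (simp add: \<Psi>_def presheaf_equivalence.\<Phi>_def[OF flip])

lemma \<Psi>_distributor: "distributor Q B A \<Psi>"
  unfolding \<Psi>_eq by (rule presheaf_equivalence.\<Phi>_distributor[OF flip])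

lemma \<Psi>_eq_PB:
  assumes "a \<in> Ob A" "b \<in> Ob B"
  shows "\<Psi> (a, b) = PB (F (yoneda A a), yoneda B b)"
  using assms adjunction[OF y_S y_T] yoneda_lemma[OF A _ S_Ob[OF G_S[OF y_T]]] by (simp add: \<Psi>_apply)

lemma \<Phi>_eq_PB:
  assumes "a \<in> Ob A" "b \<in> Ob B"
  shows "\<Phi> (b, a) = PB (yoneda B b, F (yoneda A a))"
  using assms yoneda_lemma[OF B _ T_Ob[OF F_T[OF y_S]]] by (simp add: \<Phi>_apply)

lemma F_fully_faithful:
  assumes "a \<in> Ob A" "a' \<in> Ob A"
  shows "PB (F (yoneda A a'), F (yoneda A a)) = Ar A (a', a)"
  using adjunction[OF y_S[OF assms(2)] F_T[OF y_S[OF assms(1)]]] G_F[OF y_S[OF assms(1)]]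
    yoneda_fully_faithful[OF A assms] by simp

text \<open>Each term \<open>\<Psi>(a', b) \<cdot> \<Phi>(b, a)\<close> is a composite
  \<open>P B (F(y a'), y b) \<cdot> P B (y b, F(y a))\<close>, hence below \<open>P B (F(y a'), F(y a)) = A(a', a)\<close>.\<close>

lemma comp_le: 
  assumes a: "a \<in> Ob A" and a': "a' \<in> Ob A"
  shows "dist_comp Q A B A \<Psi> \<Phi> (a', a) \<preceq> Ar A (a', a)"
proof (rule dist_comp_least[OF \<Phi>_distributor \<Psi>_distributor a a'])
  fix b assume b: "b \<in> Ob B"
  show "\<Psi> (a', b) \<cdot> \<Phi> (b, a) \<preceq> Ar A (a', a)"
    using qcategory_comp[OF presheaves_qcategory[OF B] T_Ob[OF F_T[OF y_S[OF a]]] T_Ob[OF y_T[OF b]]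
        T_Ob[OF F_T[OF y_S[OF a']]]]
    by (simp add: \<Phi>_eq_PB[OF a b] \<Psi>_eq_PB[OF a' b] F_fully_faithful[OF a a'])
qed (use qcategory_Obj[OF A] qcategory_hom[OF A] a a' in auto)

lemma comp_eqI:
  assumes "\<And>a a'. a \<in> Ob A \<Longrightarrow> a' \<in> Ob A \<Longrightarrow> Ar A (a', a) \<preceq> dist_comp Q A B A \<Psi> \<Phi> (a', a)"
  shows "dist_comp Q A B A \<Psi> \<Phi> = Ar A"
  by (rule distributor_eqI[OF dist_comp_distributor[OF A A \<Phi>_distributor \<Psi>_distributor]
        qcategory_distributor[OF A]]) (simp_all add: comp_le assms)

text \<open>Put \<open>q = \<Phi> \<otimes> p\<close>. By the adjunction \<open>F p \<le> q\<close> amounts to \<open>p \<le> G q\<close>, and by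
  Yoneda \<open>G q a = P A (y a, G q) = P B (F(y a), q)\<close>. So what is required is
  \<open>F(y a)(b) \<cdot> p a \<le> q b\<close>, where the left-hand side is one of the terms whose join is
  \<open>q b\<close>. The adjunction needs \<open>q\<close> to belong to \<open>T\<close>.\<close>

lemma F_le_pushforward:
  assumes p: "p \<in> S" and ext: "pushforward Q A B \<Phi> p \<in> T" and b: "b \<in> Ob B"
  shows "snd (F p) (b, ()) \<preceq> snd (pushforward Q A B \<Phi> p) (b, ())"
proof -
  let ?q = "pushforward Q A B \<Phi> p"
  note P = S_Ob[OF p] and GQ = S_Ob[OF G_S[OF ext]]
  have fst_G: "fst (G ?q) = fst p"
    using presheaf_equivalence.fst_F[OF flip ext] by simp
  have "snd p (a, ()) \<preceq> snd (G ?q) (a, ())" if a: "a \<in> Ob A" for a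
  proof -
    note FY = T_Ob[OF F_T[OF y_S[OF a]]]
    have "\<forall>b\<in>Ob B. snd (F (yoneda A a)) (b, ()) \<cdot> snd p (a, ()) \<preceq> snd ?q (b, ())"
      using pushforward_upper[OF B \<Phi>_distributor P a] a by (simp add: \<Phi>_apply)
    then have "snd p (a, ()) \<preceq> PB (F (yoneda A a), ?q)"
      using le_presheaf_Ar_iff[OF B FY T_Ob[OF ext]] presheaf_hom[OF P a] fst_F[OF y_S[OF a]] by simp
    then show ?thesis
      by (simp add: adjunction[OF y_S[OF a] ext] yoneda_lemma[OF A a GQ])
  qed
  then have "\<one>(fst p) \<preceq> PA (p, G ?q)"
    using id_le_presheaf_Ar_iff[OF A P GQ] fst_G by simp
  then have "\<one>(fst (F p)) \<preceq> PB (F p, ?q)"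
    by (simp add: adjunction[OF p ext] fst_F[OF p])
  then show ?thesis
    using id_le_presheaf_Ar_iff[OF B T_Ob[OF F_T[OF p]] T_Ob[OF ext]] fst_F[OF p] b by simp
qed

text \<open>Evaluate \<open>y a = G (F(y a)) \<le> \<Psi> \<otimes> F(y a)\<close> at \<open>a'\<close>.\<close>

lemma comp_eq_presheaves:
  assumes "S = Ob (presheaves Q A)"
  shows "dist_comp Q A B A \<Psi> \<Phi> = Ar A"
proof (rule comp_eqI)
  fix a a' assume a: "a \<in> Ob A" and a': "a' \<in> Ob A"
  let ?q = "F (yoneda A a)"
  note q = F_T[OF y_S[OF a]]
  have "pushforward Q B A \<Psi> ?q \<in> S"
    unfolding assms by (rule pushforward_Ob[OF A \<Psi>_distributor T_Ob[OF q]])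
  then have "snd (G ?q) (a', ()) \<preceq> snd (pushforward Q B A \<Psi> ?q) (a', ())"
    using presheaf_equivalence.F_le_pushforward[OF flip q _ a'] by (simp add: \<Psi>_eq)
  moreover have "snd (pushforward Q B A \<Psi> ?q) (a', ()) = dist_comp Q A B A \<Psi> \<Phi> (a', a)"
    using a a' fst_F[OF y_S[OF a]] by (simp add: pushforward_def dist_comp_def \<Phi>_apply cong: image_cong_simp)
  ultimately show "Ar A (a', a) \<preceq> dist_comp Q A B A \<Psi> \<Phi> (a', a)"
    using G_F[OF y_S[OF a]] a' by simp
qed

text \<open>Here \<open>\<Psi> \<otimes> F(y a)\<close> is not known to be a Cauchy presheaf, so the reverse inequality is taken
  from the density of representables below the Cauchy presheaf \<open>F(y a')\<close>.\<close>

lemma comp_eq_cauchy: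
  assumes "T \<subseteq> cauchy_presheaves Q B"
  shows "dist_comp Q A B A \<Psi> \<Phi> = Ar A"
proof (rule comp_eqI)
  fix a a' assume a: "a \<in> Ob A" and a': "a' \<in> Ob A"
  let ?p = "F (yoneda A a')" and ?q = "F (yoneda A a)"
  note p = F_T[OF y_S[OF a']] and q = F_T[OF y_S[OF a]]
  note ob = a a' qcategory_Obj[OF A a] qcategory_Obj[OF A a']
  have "PB (?p, ?q) \<preceq> dist_comp Q A B A \<Psi> \<Phi> (a', a)"
  proof (rule cauchy_density[OF B _ T_Ob[OF q]])
    show "?p \<in> cauchy_presheaves Q B" using p assms by blast
    show "dist_comp Q A B A \<Psi> \<Phi> (a', a) \<in> hom (fst ?q) (fst ?p)"
      using dist_comp_hom[OF \<Phi>_distributor \<Psi>_distributor ob] fst_F[OF y_S] a a' by simp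
    show "PB (?p, yoneda B b) \<cdot> snd ?q (b, ()) \<preceq> dist_comp Q A B A \<Psi> \<Phi> (a', a)" if b: "b \<in> Ob B" for b
      using dist_comp_upper[OF \<Phi>_distributor \<Psi>_distributor ob b]
      by (simp add: \<Psi>_eq_PB[OF a' b] \<Phi>_apply[OF a b])
  qed
  then show "Ar A (a', a) \<preceq> dist_comp Q A B A \<Psi> \<Phi> (a', a)"
    by (simp add: F_fully_faithful[OF a a'])
qed

lemma \<Phi>_eq: "\<Phi> = presheaf_equivalence.\<Psi> B A F"
  by (simp add: \<Phi>_def presheaf_equivalence.\<Psi>_def[OF flip])

lemma dist_isomorphicI:
  assumes "S = Ob (presheaves Q A) \<and> T = Ob (presheaves Q B) \<or>
    S \<subseteq> cauchy_presheaves Q A \<and> T \<subseteq> cauchy_presheaves Q B"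
  shows "dist_isomorphic Q A B"
proof -
  have "dist_comp Q A B A \<Psi> \<Phi> = Ar A"
    using assms comp_eq_presheaves comp_eq_cauchy by blast
  moreover have "dist_comp Q B A B \<Phi> \<Psi> = Ar B"
    using assms presheaf_equivalence.comp_eq_presheaves[OF flip] presheaf_equivalence.comp_eq_cauchy[OF flip]
    by (auto simp flip: \<Phi>_eq \<Psi>_eq)
  ultimately show ?thesis
    unfolding dist_isomorphic_def
    using \<Phi>_distributor \<Psi>_distributor by (intro bexI[of _ \<Phi>] bexI[of _ \<Psi>]) simp_all
qed

end

context quantaloid
begin

section \<open>Isomorphism of distributors and equivalence of presheaf categories\<close>

lemma dist_isomorphic_iff_cauchy_completion:
  assumes A: "qcategory Q A" and B: "qcategory Q B"
  shows "dist_isomorphic Q A B \<longleftrightarrow> qcat_equivalent Q (cauchy_completion Q A) (cauchy_completion Q B)"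
proof
  assume "dist_isomorphic Q A B"
  then obtain \<Phi> \<Psi> where d: "distributor Q A B \<Phi>" "distributor Q B A \<Psi>"
    and inv: "dist_comp Q A B A \<Psi> \<Phi> = Ar A" "dist_comp Q B A B \<Phi> \<Psi> = Ar B"
    by (auto simp: dist_isomorphic_def)
  have adj: "dist_adjoint Q A B \<Phi> \<Psi>" "dist_adjoint Q B A \<Psi> \<Phi>"
    using d inv le_refl[OF qcategory_hom[OF A]] le_refl[OF qcategory_hom[OF B]] by (auto simp: dist_adjoint_def)
  have "pushforward Q A B \<Phi> ` cauchy_presheaves Q A \<subseteq> cauchy_presheaves Q B"
    "pushforward Q B A \<Psi> ` cauchy_presheaves Q B \<subseteq> cauchy_presheaves Q A"
    by (rule image_subsetI, erule pushforward_cauchy[OF A B adj(1)] pushforward_cauchy[OF B A adj(2)])+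
  then show "qcat_equivalent Q (cauchy_completion Q A) (cauchy_completion Q B)"
    using pushforward_pseudo_section[OF A B d inv(1) cauchy_presheaves_Ob]
      pushforward_pseudo_section[OF B A d(2,1) inv(2) cauchy_presheaves_Ob]
    unfolding qcat_equivalent_iff cauchy_completion_eq by blast
next
  assume "qcat_equivalent Q (cauchy_completion Q A) (cauchy_completion Q B)"
  then obtain F G where FG: "pseudo_section Q (cauchy_completion Q A) (cauchy_completion Q B) F G"
    "pseudo_section Q (cauchy_completion Q B) (cauchy_completion Q A) G F"
    unfolding qcat_equivalent_iff by blast
  have "yoneda A ` Ob A \<subseteq> cauchy_presheaves Q A" "yoneda B ` Ob B \<subseteq> cauchy_presheaves Q B"
    using yoneda_cauchy[OF A] yoneda_cauchy[OF B] by blast+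
  then interpret presheaf_equivalence Q A B "cauchy_presheaves Q A" "cauchy_presheaves Q B" F G
    by (intro presheaf_equivalence.intro presheaf_equivalence_axioms.intro quantaloid_axioms A B
        cauchy_presheaves_Ob FG[unfolded cauchy_completion_eq])
  show "dist_isomorphic Q A B" by (rule dist_isomorphicI) simp
qed

lemma dist_isomorphic_iff_presheaves:
  assumes A: "qcategory Q A" and B: "qcategory Q B"
  shows "dist_isomorphic Q A B \<longleftrightarrow> qcat_equivalent Q (presheaves Q A) (presheaves Q B)"
proof
  assume "dist_isomorphic Q A B"
  then obtain \<Phi> \<Psi> where d: "distributor Q A B \<Phi>" "distributor Q B A \<Psi>"
    and inv: "dist_comp Q A B A \<Psi> \<Phi> = Ar A" "dist_comp Q B A B \<Phi> \<Psi> = Ar B"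
    by (auto simp: dist_isomorphic_def)
  have "pushforward Q A B \<Phi> ` Ob (presheaves Q A) \<subseteq> Ob (presheaves Q B)"
    "pushforward Q B A \<Psi> ` Ob (presheaves Q B) \<subseteq> Ob (presheaves Q A)"
    by (rule image_subsetI, erule pushforward_Ob[OF B d(1)] pushforward_Ob[OF A d(2)])+
  then have "qcat_equivalent Q (full_subcategory (presheaves Q A) (Ob (presheaves Q A)))
      (full_subcategory (presheaves Q B) (Ob (presheaves Q B)))"
    using pushforward_pseudo_section[OF A B d inv(1) order_refl]
      pushforward_pseudo_section[OF B A d(2,1) inv(2) order_refl]
    unfolding qcat_equivalent_iff by blast
  then show "qcat_equivalent Q (presheaves Q A) (presheaves Q B)"
    by (simp only: full_subcategory_Ob[OF presheaves_qcategory[OF A]] full_subcategory_Ob[OF presheaves_qcategory[OF B]])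
next
  assume "qcat_equivalent Q (presheaves Q A) (presheaves Q B)"
  then obtain F G where FG: "pseudo_section Q (presheaves Q A) (presheaves Q B) F G"
    "pseudo_section Q (presheaves Q B) (presheaves Q A) G F"
    unfolding qcat_equivalent_iff by blast
  have "yoneda A ` Ob A \<subseteq> Ob (presheaves Q A)" "yoneda B ` Ob B \<subseteq> Ob (presheaves Q B)"
    using yoneda_Ob[OF A] yoneda_Ob[OF B] by blast+
  then interpret presheaf_equivalence Q A B "Ob (presheaves Q A)" "Ob (presheaves Q B)" F G
    by (intro presheaf_equivalence.intro presheaf_equivalence_axioms.intro quantaloid_axioms A B order_refl)
      (simp_all only: full_subcategory_Ob[OF presheaves_qcategory[OF A]]
        full_subcategory_Ob[OF presheaves_qcategory[OF B]] FG)
  show "dist_isomorphic Q A B" by (rule dist_isomorphicI) simp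
qed

end

section \<open>Duality\<close>

definition op_quantaloid :: "('o, 'm) quantaloid \<Rightarrow> ('o, 'm) quantaloid" where
  "op_quantaloid Q = \<lparr>Obj = Obj Q, Arr = Arr Q, Dom = Cod Q, Cod = Dom Q, Idn = Idn Q,
     Comp = (\<lambda>g f. Comp Q f g), Le = Le Q\<rparr>"

definition op_qcat :: "('o, 'm, 'a) qcat \<Rightarrow> ('o, 'm, 'a) qcat" where
  "op_qcat A = \<lparr>Ob = Ob A, Ty = Ty A, Ar = Ar A \<circ> prod.swap\<rparr>"

lemma op_quantaloid_simps [simp]:
  "Obj (op_quantaloid Q) = Obj Q" "Idn (op_quantaloid Q) = Idn Q" "Le (op_quantaloid Q) = Le Q"
  "Comp (op_quantaloid Q) g f = Comp Q f g" "op_quantaloid (op_quantaloid Q) = Q"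
  "Hom (op_quantaloid Q) X Y = Hom Q Y X"
  "Arr (op_quantaloid Q) = Arr Q" "Dom (op_quantaloid Q) = Cod Q" "Cod (op_quantaloid Q) = Dom Q"
  by (auto simp: op_quantaloid_def Hom_def)

lemma op_qcat_simps [simp]:
  "Ob (op_qcat A) = Ob A" "Ty (op_qcat A) = Ty A" "Ar (op_qcat A) = Ar A \<circ> prod.swap"
  "op_qcat (op_qcat A) = A"
  by (simp_all add: op_qcat_def comp_assoc)

lemma op_star [simp]: "op_qcat (star Q X) = star (op_quantaloid Q) X"
  by (simp add: op_qcat_def star_def comp_def)

lemma swap_PiE:
  "\<Phi> \<circ> prod.swap \<in> (\<Pi>\<^sub>E (y, x) \<in> Y \<times> X. H x y) \<longleftrightarrow> \<Phi> \<in> (\<Pi>\<^sub>E (x, y) \<in> X \<times> Y. H x y)"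
  by (auto simp: PiE_def Pi_def extensional_def)

lemma (in quantaloid) op_quantaloid: "quantaloid (op_quantaloid Q)"
  by (rule quantaloid.intro)
    (use Dom_Obj Cod_Obj Idn_Hom Comp_Hom Comp_assoc Idn_left Idn_right Hom_sup_lattice
       Comp_Sup_left Comp_Sup_right in auto)

lemma distributor_op:
  "distributor (op_quantaloid Q) (op_qcat B) (op_qcat A) (\<Phi> \<circ> prod.swap) \<longleftrightarrow> distributor Q A B \<Phi>"
  unfolding distributor_def by (auto simp: swap_PiE)

lemma qcategory_op: "qcategory Q A \<Longrightarrow> qcategory (op_quantaloid Q) (op_qcat A)"
  unfolding qcategory_def by (auto simp: swap_PiE)

lemma dist_comp_op:
  "dist_comp (op_quantaloid Q) (op_qcat C) (op_qcat B) (op_qcat A) (\<Phi> \<circ> prod.swap) (\<Psi> \<circ> prod.swap)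
     = dist_comp Q A B C \<Psi> \<Phi> \<circ> prod.swap"
  by (auto simp: dist_comp_def restrict_def fun_eq_iff)

lemma dist_isomorphic_opI:
  assumes "dist_isomorphic Q A B"
  shows "dist_isomorphic (op_quantaloid Q) (op_qcat A) (op_qcat B)"
proof -
  from assms obtain \<Phi> \<Psi> where d: "distributor Q A B \<Phi>" "distributor Q B A \<Psi>"
    and inv: "dist_comp Q A B A \<Psi> \<Phi> = Ar A" "dist_comp Q B A B \<Phi> \<Psi> = Ar B"
    by (auto simp: dist_isomorphic_def Dist_def)
  show ?thesis
    unfolding dist_isomorphic_def Dist_def
    by (intro bexI[of _ "\<Psi> \<circ> prod.swap"] bexI[of _ "\<Phi> \<circ> prod.swap"])
      (simp_all add: distributor_op d dist_comp_op inv)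
qed

lemma dist_isomorphic_op:
  "dist_isomorphic (op_quantaloid Q) (op_qcat A) (op_qcat B) \<longleftrightarrow> dist_isomorphic Q A B"
  using dist_isomorphic_opI[of Q A B] dist_isomorphic_opI[of "op_quantaloid Q" "op_qcat A" "op_qcat B"] by auto

lemma swap_unit [simp]: "\<Upsilon> \<circ> prod.swap = (\<Upsilon> :: unit \<times> unit \<Rightarrow> 'm)"
  by (simp add: fun_eq_iff)

text \<open>An extension over \<open>Q\<close> is a lifting over the opposite quantaloid. Exchanging the arguments of a
  family indexed by \<open>unit \<times> unit\<close> changes nothing, so the solution itself needs no reindexing.\<close>

lemma dist_ext_op:
  fixes \<phi> \<psi> :: "unit \<times> 'a \<Rightarrow> 'm"
  shows "dist_ext Q A (star Q X) (star Q Y) \<phi> \<psi> =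
    dist_lift (op_quantaloid Q) (star (op_quantaloid Q) Y) (star (op_quantaloid Q) X) (op_qcat A)
      (\<phi> \<circ> prod.swap) (\<psi> \<circ> prod.swap)"
proof -
  have "distributor Q (star Q X) (star Q Y) \<Upsilon> \<longleftrightarrow>
      distributor (op_quantaloid Q) (star (op_quantaloid Q) Y) (star (op_quantaloid Q) X) \<Upsilon>" for \<Upsilon>
    using distributor_op[of Q "star Q Y" "star Q X" \<Upsilon>] by simp
  moreover have "dist_comp (op_quantaloid Q) (star (op_quantaloid Q) Y) (star (op_quantaloid Q) X) (op_qcat A)
      (\<phi> \<circ> prod.swap) \<Upsilon> = dist_comp Q A (star Q X) (star Q Y) \<Upsilon> \<phi> \<circ> prod.swap" for \<Upsilon>
    using dist_comp_op[of Q "star Q Y" "star Q X" A \<phi> \<Upsilon>] by simp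
  ultimately show ?thesis
    unfolding dist_ext_def dist_lift_def greatest_def Lower_def
    by (simp add: Dist_def star_def)
qed

text \<open>Mutually inverse bijections on objects that preserve types and reverse hom-arrows: an isomorphism of
  \<open>C\<close> with the opposite of \<open>C'\<close>.\<close>

definition dual_iso ::
  "('o, 'm, 'a) qcat \<Rightarrow> ('o, 'm, 'b) qcat \<Rightarrow> ('a \<Rightarrow> 'b) \<Rightarrow> ('b \<Rightarrow> 'a) \<Rightarrow> bool" where
  "dual_iso C C' s s' \<longleftrightarrow>
     (\<forall>c\<in>Ob C. s c \<in> Ob C' \<and> s' (s c) = c \<and> Ty C' (s c) = Ty C c) \<and>
     (\<forall>c\<in>Ob C'. s' c \<in> Ob C \<and> s (s' c) = c) \<and>
     (\<forall>c\<in>Ob C. \<forall>d\<in>Ob C. Ar C (c, d) = Ar C' (s d, s c))"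

lemma dual_iso_sym: "dual_iso C C' s s' \<Longrightarrow> dual_iso C' C s' s"
  by (simp add: dual_iso_def) metis

text \<open>Both inequalities \<open>1 \<le> C (G (F c), c)\<close> and \<open>1 \<le> C (c, G (F c))\<close> are demanded, so
  reversing the hom-arrows only exchanges them; the order and the identities of the opposite quantaloid
  are those of \<open>Q\<close>.\<close>

lemma pseudo_section_dual:
  assumes F: "pseudo_section Q C D F G" and G: "pseudo_section Q D C G F"
    and s: "dual_iso C C' s s'" and t: "dual_iso D D' t t'"
  shows "pseudo_section (op_quantaloid Q) C' D' (t \<circ> F \<circ> s') (s \<circ> G \<circ> t')"
proof -
  have s': "s' c \<in> Ob C" "Ty C (s' c) = Ty C' c" "s (s' c) = c" if "c \<in> Ob C'" for c
    using s that unfolding dual_iso_def by metis+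
  have Ar_s: "Ar C (c, d) = Ar C' (s d, s c)" if "c \<in> Ob C" "d \<in> Ob C" for c d
    using s that by (simp add: dual_iso_def)
  have t': "t d \<in> Ob D'" "Ty D' (t d) = Ty D d" "t' (t d) = d" if "d \<in> Ob D" for d
    using t that by (auto simp: dual_iso_def)
  have Ar_t: "Ar D (c, d) = Ar D' (t d, t c)" if "c \<in> Ob D" "d \<in> Ob D" for c d
    using t that by (simp add: dual_iso_def)
  have F': "F c \<in> Ob D" "Ty D (F c) = Ty C c" "Idn Q (Ty C c) \<preceq>\<^bsub>Q\<^esub> Ar C (G (F c), c)"
    "Idn Q (Ty C c) \<preceq>\<^bsub>Q\<^esub> Ar C (c, G (F c))" "G (F c) \<in> Ob C" if "c \<in> Ob C" for c
    using F G that by (auto simp: pseudo_section_def)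
  have mono: "Ar C (c', c) \<preceq>\<^bsub>Q\<^esub> Ar D (F c', F c)" if "c \<in> Ob C" "c' \<in> Ob C" for c c'
    using F that by (simp add: pseudo_section_def)
  show ?thesis
    unfolding pseudo_section_def
  proof (intro conjI ballI)
    fix c assume c: "c \<in> Ob C'"
    note sc = s'[OF c] and Fc = F'[OF s'(1)[OF c]]
    show "(t \<circ> F \<circ> s') c \<in> Ob D'" "Ty D' ((t \<circ> F \<circ> s') c) = Ty C' c"
      using t'[OF Fc(1)] Fc sc by simp_all
    show "Idn (op_quantaloid Q) (Ty C' c) \<preceq>\<^bsub>op_quantaloid Q\<^esub> Ar C' ((s \<circ> G \<circ> t') ((t \<circ> F \<circ> s') c), c)"
      "Idn (op_quantaloid Q) (Ty C' c) \<preceq>\<^bsub>op_quantaloid Q\<^esub> Ar C' (c, (s \<circ> G \<circ> t') ((t \<circ> F \<circ> s') c))"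
      using t'[OF Fc(1)] Fc(3,4) sc Ar_s[OF Fc(5) sc(1)] Ar_s[OF sc(1) Fc(5)] by simp_all
    fix c' assume c': "c' \<in> Ob C'"
    note sc' = s'[OF c'] and Fc' = F'[OF s'(1)[OF c']]
    show "Ar C' (c', c) \<preceq>\<^bsub>op_quantaloid Q\<^esub> Ar D' ((t \<circ> F \<circ> s') c', (t \<circ> F \<circ> s') c)"
      using mono[OF sc'(1) sc(1)] Ar_s[OF sc(1) sc'(1)] Ar_t[OF Fc(1) Fc'(1)] sc(3) sc'(3) by simp
  qed
qed

lemma qcat_equivalent_dual:
  assumes "dual_iso C C' s s'" "dual_iso D D' t t'"
  shows "qcat_equivalent (op_quantaloid Q) C' D' \<longleftrightarrow> qcat_equivalent Q C D"
proof
  assume "qcat_equivalent Q C D"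
  then obtain F G where FG: "pseudo_section Q C D F G" "pseudo_section Q D C G F"
    by (auto simp: qcat_equivalent_iff)
  show "qcat_equivalent (op_quantaloid Q) C' D'"
    using pseudo_section_dual[OF FG assms] pseudo_section_dual[OF FG(2,1) assms(2,1)]
    unfolding qcat_equivalent_iff by blast
next
  assume "qcat_equivalent (op_quantaloid Q) C' D'"
  then obtain F G where FG: "pseudo_section (op_quantaloid Q) C' D' F G"
      "pseudo_section (op_quantaloid Q) D' C' G F"
    by (auto simp: qcat_equivalent_iff)
  show "qcat_equivalent Q C D"
    using pseudo_section_dual[OF FG assms[THEN dual_iso_sym]]
      pseudo_section_dual[OF FG(2,1) assms(2,1)[THEN dual_iso_sym]]
    unfolding qcat_equivalent_iff op_quantaloid_simps by blast
qed

text \<open>Swapping the arguments of a family turns copresheaves into presheaves over the opposite. The arrow from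
  \<open>\<phi>\<close> to \<open>\<psi>\<close> in one category is an extension along \<open>\<phi>\<close>, in the other a
  lifting through \<open>\<phi>\<close>, which explains the reversal of hom-arrows.\<close>

lemma copresheaves_dual:
  "dual_iso (copresheaves Q A) (presheaves (op_quantaloid Q) (op_qcat A))
     (\<lambda>(X, \<phi>). (X, \<phi> \<circ> prod.swap)) (\<lambda>(X, \<phi>). (X, \<phi> \<circ> prod.swap))"
proof -
  have "distributor (op_quantaloid Q) (star (op_quantaloid Q) X) (op_qcat A) (\<phi> \<circ> prod.swap) \<longleftrightarrow>
      distributor Q A (star Q X) \<phi>" for X \<phi>
    using distributor_op[of Q "star Q X" A \<phi>] by simp
  moreover have "distributor (op_quantaloid Q) (star (op_quantaloid Q) X) (op_qcat A) \<phi> \<longleftrightarrow>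
      distributor Q A (star Q X) (\<phi> \<circ> prod.swap)" for X \<phi>
    using distributor_op[of Q "star Q X" A "\<phi> \<circ> prod.swap"] by (simp add: comp_assoc)
  ultimately show ?thesis
    unfolding dual_iso_def
    by (auto simp: copresheaves_def presheaves_def Let_def dist_ext_op comp_assoc)
qed

theorem proposition7p15:
  fixes Q :: "('o, 'm) quantaloid"
    and A :: "('o, 'm, 'a) qcat"
    and B :: "('o, 'm, 'b) qcat"
  assumes "quantaloid Q" "qcategory Q A" "qcategory Q B"
  shows "(dist_isomorphic Q A B
            \<longleftrightarrow> qcat_equivalent Q (cauchy_completion Q A) (cauchy_completion Q B)) \<and>
         (qcat_equivalent Q (cauchy_completion Q A) (cauchy_completion Q B)
            \<longleftrightarrow> qcat_equivalent Q (presheaves Q A) (presheaves Q B)) \<and>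
         (qcat_equivalent Q (presheaves Q A) (presheaves Q B)
            \<longleftrightarrow> qcat_equivalent Q (copresheaves Q A) (copresheaves Q B))"
proof -
  interpret quantaloid Q by (rule assms(1))
  interpret op: quantaloid "op_quantaloid Q" by (rule op_quantaloid)
  show ?thesis
    using dist_isomorphic_iff_cauchy_completion[OF assms(2,3)] dist_isomorphic_iff_presheaves[OF assms(2,3)]
      op.dist_isomorphic_iff_presheaves[OF assms(2,3)[THEN qcategory_op]]
      dist_isomorphic_op[of Q A B] qcat_equivalent_dual[OF copresheaves_dual[of Q A] copresheaves_dual[of Q B], of Q]
    by simp
qed

end
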